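(* Let $\Omega$ be a set; all groups below are $\Omega$-groups. (1) Let $G$ be an $\Omega$-group, $I$ a set, and $(H_i)_{i\in I}$ a family of $\Omega$-subgroups of $G$ satisfying (CC) and such that $\theta^H_G\colon\bigoplus_{i\in I}H_i\to G$ is bijective. Let $S$ be any simple $\Omega$-group. Then: (a) $\operatorname{soc}(H_i)$ is an $\Omega$-subgroup of $\operatorname{soc}(G)$ and $(H_i)_S$ is an $\Omega$-subgroup of $G_S$ for every $i\in I$; (b) the families $(\operatorname{soc}(H_i))_{i\in I}$ (of $\Omega$-subgroups of $\operatorname{soc}(G)$) and $((H_i)_S)_{i\in I}$ (of $\Omega$-subgroups of $G_S$) satisfy (CC); (c) the canonical morphisms $\bigoplus_{i\in I}\operatorname{soc}(H_i)\to\operatorname{soc}(G)$ and $\bigoplus_{i\in I}(H_i)_S\to G_S$ (whose composition with each canonical injection is the corresponding inclusion) are bijective; (d) $\operatorname{Supp}(G)=\bigcup_{i\in I}\operatorname{Supp}(H_i)$. (2) For every $\Omega$-group $G$ and every simple $\Omega$-group $S$, one has $G_S=(\operatorname{soc}(G))_S$ and $\operatorname{Supp}(G)=\operatorname{Supp}(\operatorname{soc}(G))$. (3) Let $G$ and $G'$ be semisimple $\Omega$-groups and put $\mathcal{S}=\operatorname{Supp}(G)\cap\operatorname{Supp}(G')$. Then: (a) for every normal morphism $f\colon G\to G'$ and every simple $\Omega$-group $S$, the $S$-component $f_S\colon G_S\to G'_S$ is a normal morphism; (b) the map $$\Phi\colon \operatorname{Hom}_n(G,G')\to\prod_{S\in\mathcal{S}}\operatorname{Hom}_n(G_S,G'_S),\qquad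 \Phi(f)=(f_S)_{S\in\mathcal{S}},$$ is a bijection.
   Context: An $\Omega$-group is a group $G$ with a map $\Omega\times G\to G$, $(\omega,x)\mapsto x^\omega$, such that each $x\mapsto x^\omega$ is an endomorphism; morphisms are homomorphisms commuting with the operators; $\Omega$-subgroups are operator-stable subgroups. An $\Omega$-group is simple if it is nontrivial and has no normal $\Omega$-subgroups other than the trivial one and itself. For an $\Omega$-group $G$, $\mathcal{Z}(G)$ is the set of normal $\Omega$-subgroups of $G$ that are simple $\Omega$-groups; $\operatorname{soc}(G)$ is the $\Omega$-subgroup generated by $\bigcup\mathcal{Z}(G)$; for a simple $\Omega$-group $S$, $G_S$ is the $\Omega$-subgroup generated by the union of all $H\in\mathcal{Z}(G)$ isomorphic to $S$. For each $\Omega$-group $H$, $[H]$ denotes a canonically chosen representative of its isomorphism class ($[H]\cong H$, $[[H]]=[H]$, $[H]=[K]$ iff $H\cong K$), and $\operatorname{Supp}(G)=\{[H]:H\in\mathcal{Z}(G)\}$. $G$ is semisimple if $G=\operatorname{soc}(G)$ (equivalently, $G$ is isomorphic to a restricted direct sum of simple $\Omega$-groups). The restricted direct sum $\bigoplus_{i\in I}G_i$ is the $\Omega$-subgroup of $\prod_i G_i$ (componentwise operators) of finitely supported families. A family $(H_i)_{i\in I}$ of $\Omega$-subgroups of $G$ satisfies (CC) if $H_j$ centralises $H_i$ for all distinct $i,j$; then $\theta^H_G\colon\bigoplus_i H_i\to G$ is the unique morphism restricting to the inclusion $H_i\hookrightarrow G$ on each summand. A morphism $f\colon G\to G'$ is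 normal if $f(N)$ is a normal $\Omega$-subgroup of $G'$ for every normal $\Omega$-subgroup $N$ of $G$; $\operatorname{Hom}_n(G,G')$ is the set of normal morphisms $G\to G'$. For a normal morphism $f\colon G\to G'$ and a simple $\Omega$-group $S$ one has $f(G_S)\subseteq G'_S$, and the $S$-component $f_S\colon G_S\to G'_S$ is the restriction of $f$ to $G_S$ with codomain $G'_S$. *)

theory Defs
  imports "HOL-Algebra.Algebra"
begin

record ('w, 'a) omonoid = "'a monoid" + opr :: "'w \<Rightarrow> 'a \<Rightarrow> 'a"

definition ogroup :: "'w set \<Rightarrow> ('w, 'a) omonoid \<Rightarrow> bool" where
  "ogroup Om G \<longleftrightarrow> group G \<and> (\<forall>w\<in>Om. opr G w \<in> hom G G)"

definition osub :: "('w, 'a) omonoid \<Rightarrow> 'a set \<Rightarrow> ('w, 'a) omonoid" where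
  "osub G H = G\<lparr>carrier := H\<rparr>"

definition osubgroup :: "'w set \<Rightarrow> 'a set \<Rightarrow> ('w, 'a) omonoid \<Rightarrow> bool" where
  "osubgroup Om H G \<longleftrightarrow> subgroup H G \<and> (\<forall>w\<in>Om. \<forall>x\<in>H. opr G w x \<in> H)"

definition onormal :: "'w set \<Rightarrow> 'a set \<Rightarrow> ('w, 'a) omonoid \<Rightarrow> bool" where
  "onormal Om N G \<longleftrightarrow> osubgroup Om N G \<and> N \<lhd> G"

definition omor :: "'w set \<Rightarrow> ('w, 'a) omonoid \<Rightarrow> ('w, 'b) omonoid \<Rightarrow> ('a \<Rightarrow> 'b) \<Rightarrow> bool" where
  "omor Om G G' f \<longleftrightarrow> f \<in> hom G G' \<and>
     (\<forall>w\<in>Om. \<forall>x\<in>carrier G. f (opr G w x) = opr G' w (f x))"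

definition oiso :: "'w set \<Rightarrow> ('w, 'a) omonoid \<Rightarrow> ('w, 'b) omonoid \<Rightarrow> bool" where
  "oiso Om G G' \<longleftrightarrow> ogroup Om G \<and> ogroup Om G' \<and>
     (\<exists>f. omor Om G G' f \<and> bij_betw f (carrier G) (carrier G'))"

definition osimple :: "'w set \<Rightarrow> ('w, 'a) omonoid \<Rightarrow> bool" where
  "osimple Om G \<longleftrightarrow> ogroup Om G \<and> carrier G \<noteq> {\<one>\<^bsub>G\<^esub>} \<and>
     (\<forall>N. onormal Om N G \<longrightarrow> N = {\<one>\<^bsub>G\<^esub>} \<or> N = carrier G)"

definition Zset :: "'w set \<Rightarrow> ('w, 'a) omonoid \<Rightarrow> 'a set set" where
  "Zset Om G = {H. onormal Om H G \<and> osimple Om (osub G H)}"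

definition ogen :: "'w set \<Rightarrow> ('w, 'a) omonoid \<Rightarrow> 'a set \<Rightarrow> 'a set" where
  "ogen Om G A = \<Inter> {H. osubgroup Om H G \<and> A \<subseteq> H}"

definition soc :: "'w set \<Rightarrow> ('w, 'a) omonoid \<Rightarrow> 'a set" where
  "soc Om G = ogen Om G (\<Union> (Zset Om G))"

definition compC :: "'w set \<Rightarrow> ('w, 'a) omonoid \<Rightarrow> ('w, 'c) omonoid set \<Rightarrow> 'a set" where
  "compC Om G C = ogen Om G (\<Union> {H \<in> Zset Om G. \<exists>K\<in>C. oiso Om (osub G H) K})"

definition Gcomp :: "'w set \<Rightarrow> ('w, 'a) omonoid \<Rightarrow> ('w, 'c) omonoid \<Rightarrow> 'a set" where
  "Gcomp Om G S = compC Om G {S}"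

text \<open>Canonical representative [H] of the isomorphism class of H: the class itself
  (all Omega-groups with carriers in the same type that are isomorphic to H).\<close>
definition isoclass :: "'w set \<Rightarrow> ('w, 'a) omonoid \<Rightarrow> ('w, 'a) omonoid set" where
  "isoclass Om H = {K. oiso Om K H}"

definition Supp :: "'w set \<Rightarrow> ('w, 'a) omonoid \<Rightarrow> ('w, 'a) omonoid set set" where
  "Supp Om G = {isoclass Om (osub G H) | H. H \<in> Zset Om G}"

text \<open>Supp(G) \<inter> Supp(G') for G, G' possibly on different carrier types: the classes
  of Supp(G) that also occur (up to isomorphism) in Z(G').\<close>
definition Supp_meet :: "'w set \<Rightarrow> ('w, 'a) omonoid \<Rightarrow> ('w, 'b) omonoid \<Rightarrow> ('w, 'a) omonoid set set" where
  "Supp_meet Om G G' = {C \<in> Supp Om G. \<exists>H'\<in>Zset Om G'. \<exists>K\<in>C. oiso Om (osub G' H') K}"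

definition semisimple :: "'w set \<Rightarrow> ('w, 'a) omonoid \<Rightarrow> bool" where
  "semisimple Om G \<longleftrightarrow> ogroup Om G \<and> soc Om G = carrier G"

definition odsum :: "'w set \<Rightarrow> 'i set \<Rightarrow> ('i \<Rightarrow> ('w, 'a) omonoid) \<Rightarrow> ('w, 'i \<Rightarrow> 'a) omonoid" where
  "odsum Om I Gs = omonoid.make
     {x. x \<in> (\<Pi>\<^sub>E i\<in>I. carrier (Gs i)) \<and> finite {i\<in>I. x i \<noteq> \<one>\<^bsub>Gs i\<^esub>}}
     (\<lambda>x y. \<lambda>i\<in>I. x i \<otimes>\<^bsub>Gs i\<^esub> y i)
     (\<lambda>i\<in>I. \<one>\<^bsub>Gs i\<^esub>)
     (\<lambda>w x. \<lambda>i\<in>I. opr (Gs i) w (x i))"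

definition oinj :: "('w, 'a) omonoid \<Rightarrow> 'i set \<Rightarrow> 'i \<Rightarrow> 'a \<Rightarrow> ('i \<Rightarrow> 'a)" where
  "oinj G I i x = (\<lambda>j\<in>I. if j = i then x else \<one>\<^bsub>G\<^esub>)"

definition CC :: "('w, 'a) omonoid \<Rightarrow> 'i set \<Rightarrow> ('i \<Rightarrow> 'a set) \<Rightarrow> bool" where
  "CC G I H \<longleftrightarrow> (\<forall>i\<in>I. \<forall>j\<in>I. i \<noteq> j \<longrightarrow> (\<forall>x\<in>H i. \<forall>y\<in>H j. x \<otimes>\<^bsub>G\<^esub> y = y \<otimes>\<^bsub>G\<^esub> x))"

definition theta :: "'w set \<Rightarrow> 'i set \<Rightarrow> ('i \<Rightarrow> 'a set) \<Rightarrow> ('w, 'a) omonoid \<Rightarrow> ('i \<Rightarrow> 'a) \<Rightarrow> 'a" where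
  "theta Om I H G = (THE t. omor Om (odsum Om I (\<lambda>i. osub G (H i))) G t \<and>
      t \<in> extensional (carrier (odsum Om I (\<lambda>i. osub G (H i)))) \<and>
      (\<forall>i\<in>I. \<forall>x\<in>H i. t (oinj G I i x) = x))"

definition Hom_n :: "'w set \<Rightarrow> ('w, 'a) omonoid \<Rightarrow> ('w, 'b) omonoid \<Rightarrow> ('a \<Rightarrow> 'b) set" where
  "Hom_n Om G G' = {f. omor Om G G' f \<and> f \<in> extensional (carrier G) \<and>
      (\<forall>N. onormal Om N G \<longrightarrow> onormal Om (f ` N) G')}"

end

theory Submission
  imports Defs
begin

text \<open>
  Distinct members of \<open>\<Z>(G)\<close> meet trivially, hence commute. If \<open>\<Z>(G)\<close> generates \<open>G\<close>, Zorn's lemma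
  yields a normal complement for every normal \<open>\<Omega>\<close>-subgroup \<open>N\<close>, so that \<open>N\<close> is the image of a
  normal idempotent endomorphism of \<open>G\<close>. Such a retraction onto a simple \<open>N\<close> is an isomorphism on any
  \<open>H \<in> \<Z>(G)\<close> that it does not kill, and this controls which isomorphism types occur inside \<open>soc G\<close>;
  a retraction onto an arbitrary \<open>N\<close> shows that \<open>N\<close> is generated by the members of \<open>\<Z>(G)\<close>
  it contains. For an internal direct sum the coordinate projections carry each \<open>K \<in> \<Z>(G)\<close> to a
  trivial group or to a copy of \<open>K\<close> in \<open>\<Z>(H\<^sub>i)\<close>. For semisimple \<open>G\<close> the inverse of \<open>\<Phi>\<close> sends a family
  \<open>(h\<^sub>S)\<close> to the pointwise product of the commuting morphisms \<open>h\<^sub>S \<circ> p\<^sub>S\<close>, where \<open>p\<^sub>S\<close> retracts \<open>G\<close>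
  onto \<open>G\<^sub>S\<close>.
\<close>

section \<open>Operator groups\<close>

text \<open>Operators are arbitrary endomorphisms, so centralisers and preimages under conjugation
  need not be operator-stable, although generation hypotheses have to be tested against them. The
  way out: the plain subgroup generated by a union of \<Omega>-subgroups is already operator-stable,
  so containment in any plain subgroup can be checked on generators. The other obstacle is
  normality, which is not transitive and is not preserved by morphisms. Commutation repairs both:
  conjugation in a product of commuting factors acts on one factor only through the matching
  coordinate. This makes projections normal, and it makes a normal subgroup of a direct summand, or
  of an isotypic component of a semisimple group, normal in the whole group. Zorn is spent on
  complements, so no decomposition into simple summands is ever chosen, and a retraction with kernel
  \<open>N\<close> replaces the quotient by \<open>N\<close>. Types outside \<open>Supp_meet\<close>
  do not enter \<Phi> because every normal morphism kills their members.\<close>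

lemma osub_simps [simp]:
  "carrier (osub G H) = H" "\<one>\<^bsub>osub G H\<^esub> = \<one>\<^bsub>G\<^esub>" "x \<otimes>\<^bsub>osub G H\<^esub> y = x \<otimes>\<^bsub>G\<^esub> y"
  "opr (osub G H) = opr G" "osub (osub G H) K = osub G K"
  by (simp_all add: osub_def)

lemma osub_carrier [simp]: "osub G (carrier G) = G"
  by (simp add: osub_def)

lemma ogroup_group: "ogroup Om G \<Longrightarrow> group G"
  by (simp add: ogroup_def)

lemma opr_hom: "ogroup Om G \<Longrightarrow> w \<in> Om \<Longrightarrow> opr G w \<in> hom G G"
  by (simp add: ogroup_def)

lemma opr_closed: "ogroup Om G \<Longrightarrow> w \<in> Om \<Longrightarrow> x \<in> carrier G \<Longrightarrow> opr G w x \<in> carrier G"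
  by (auto dest!: opr_hom simp: hom_def)

lemma opr_mult:
  "ogroup Om G \<Longrightarrow> w \<in> Om \<Longrightarrow> x \<in> carrier G \<Longrightarrow> y \<in> carrier G \<Longrightarrow>
    opr G w (x \<otimes>\<^bsub>G\<^esub> y) = opr G w x \<otimes>\<^bsub>G\<^esub> opr G w y"
  by (auto dest!: opr_hom simp: hom_def)

lemma opr_one: "ogroup Om G \<Longrightarrow> w \<in> Om \<Longrightarrow> opr G w \<one>\<^bsub>G\<^esub> = \<one>\<^bsub>G\<^esub>"
  by (auto intro: hom_one opr_hom ogroup_group)

lemma opr_inv:
  "ogroup Om G \<Longrightarrow> w \<in> Om \<Longrightarrow> x \<in> carrier G \<Longrightarrow> opr G w (inv\<^bsub>G\<^esub> x) = inv\<^bsub>G\<^esub> (opr G w x)"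
  by (rule group_hom.hom_inv) (auto simp: group_hom_def group_hom_axioms_def ogroup_group opr_hom)

lemma osubgroupD:
  assumes "osubgroup Om H G"
  shows "subgroup H G" "H \<subseteq> carrier G" "\<one>\<^bsub>G\<^esub> \<in> H"
    "\<And>x y. x \<in> H \<Longrightarrow> y \<in> H \<Longrightarrow> x \<otimes>\<^bsub>G\<^esub> y \<in> H" "\<And>x. x \<in> H \<Longrightarrow> inv\<^bsub>G\<^esub> x \<in> H"
    "\<And>w x. w \<in> Om \<Longrightarrow> x \<in> H \<Longrightarrow> opr G w x \<in> H"
  using assms by (auto simp: osubgroup_def subgroup_def)

lemma onormal_iff:
  assumes "ogroup Om G"
  shows "onormal Om N G \<longleftrightarrow> osubgroup Om N G \<and>
    (\<forall>g\<in>carrier G. \<forall>n\<in>N. g \<otimes>\<^bsub>G\<^esub> n \<otimes>\<^bsub>G\<^esub> inv\<^bsub>G\<^esub> g \<in> N)"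
  using group.normal_inv_iff[OF ogroup_group[OF assms]]
  by (auto simp: onormal_def osubgroup_def)

lemma onormal_osubgroup: "onormal Om N G \<Longrightarrow> osubgroup Om N G"
  by (simp add: onormal_def)

lemma osubgroup_carrier: "ogroup Om G \<Longrightarrow> osubgroup Om (carrier G) G"
  by (simp add: osubgroup_def group.subgroup_self ogroup_group opr_closed)

lemma osub_ogroup:
  assumes "ogroup Om G" "osubgroup Om H G"
  shows "ogroup Om (osub G H)"
proof -
  have "group (osub G H)"
    using assms group.subgroup_imp_group[OF ogroup_group[OF assms(1)] osubgroupD(1)[OF assms(2)]]
    by (simp add: osub_def)
  moreover have "opr G w \<in> hom (osub G H) (osub G H)" if "w \<in> Om" for w
    using that assms osubgroupD[OF assms(2)] by (auto simp: hom_def intro!: opr_mult)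
  ultimately show ?thesis by (simp add: ogroup_def)
qed

lemma osub_inv:
  assumes "ogroup Om G" "osubgroup Om H G" "x \<in> H"
  shows "inv\<^bsub>osub G H\<^esub> x = inv\<^bsub>G\<^esub> x"
  using group.m_inv_consistent[OF ogroup_group[OF assms(1)] osubgroupD(1)[OF assms(2)] assms(3)]
  by (simp add: osub_def)

lemma osubgroup_osub_iff:
  assumes "ogroup Om G" "osubgroup Om H G"
  shows "osubgroup Om K (osub G H) \<longleftrightarrow> osubgroup Om K G \<and> K \<subseteq> H"
proof -
  have "subgroup K (osub G H) \<longleftrightarrow> subgroup K G \<and> K \<subseteq> H"
    using osubgroupD(2)[OF assms(2)] osub_inv[OF assms]
    by (auto simp: subgroup_def) (metis subset_iff)+
  then show ?thesis by (auto simp: osubgroup_def)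
qed

text \<open>Conjugation is expressed with the operations of \<open>G\<close>, so that later
  arguments never meet the inverse of \<open>osub G H\<close>.\<close>

lemma onormal_osub_iff:
  assumes "ogroup Om G" "osubgroup Om H G"
  shows "onormal Om K (osub G H) \<longleftrightarrow> osubgroup Om K G \<and> K \<subseteq> H \<and>
    (\<forall>g\<in>H. \<forall>n\<in>K. g \<otimes>\<^bsub>G\<^esub> n \<otimes>\<^bsub>G\<^esub> inv\<^bsub>G\<^esub> g \<in> K)"
  using osub_inv[OF assms] osubgroup_osub_iff[OF assms]
  by (auto simp: onormal_iff[OF osub_ogroup[OF assms]])

lemma onormal_osub:
  assumes "ogroup Om G" "onormal Om K G" "osubgroup Om H G" "K \<subseteq> H"
  shows "onormal Om K (osub G H)"
  using assms osubgroupD(2)[OF assms(3)]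
  by (auto simp: onormal_osub_iff onormal_iff)

lemma onormal_one: "ogroup Om G \<Longrightarrow> onormal Om {\<one>\<^bsub>G\<^esub>} G"
  by (simp add: onormal_def osubgroup_def group.one_is_normal normal_imp_subgroup opr_one ogroup_group)

lemma onormal_Int:
  assumes "ogroup Om G" "onormal Om M G" "onormal Om N G"
  shows "onormal Om (M \<inter> N) G"
proof -
  interpret group G by (rule ogroup_group[OF assms(1)])
  show ?thesis using assms subgroups_Inter_pair[of M N]
    by (auto simp: onormal_iff osubgroup_def)
qed

text \<open>The commutator of \<open>x\<close> and \<open>y\<close> lies in \<open>N\<close> because
  \<open>N\<close> absorbs conjugation by \<open>x\<close>, and in \<open>M\<close> because
  \<open>M\<close> absorbs conjugation by \<open>y\<close>.\<close>

lemma onormal_Int_one_commute: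
  fixes G :: "('w, 'a) omonoid" (structure)
  assumes "ogroup Om G" "onormal Om M G" "onormal Om N G" "M \<inter> N = {\<one>\<^bsub>G\<^esub>}" "x \<in> M" "y \<in> N"
  shows "x \<otimes>\<^bsub>G\<^esub> y = y \<otimes>\<^bsub>G\<^esub> x"
proof -
  interpret group G by (rule ogroup_group[OF assms(1)])
  note M = osubgroupD[OF onormal_osubgroup[OF assms(2)]]
  note N = osubgroupD[OF onormal_osubgroup[OF assms(3)]]
  have c: "x \<in> carrier G" "y \<in> carrier G" using M N assms by auto
  have "x \<otimes> y \<otimes> inv x \<in> N" using assms c by (auto simp: onormal_iff)
  then have 1: "x \<otimes> y \<otimes> inv x \<otimes> inv y \<in> N" using N assms by auto
  have "y \<otimes> inv x \<otimes> inv y \<in> M" using assms c M by (auto simp: onormal_iff)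
  then have "x \<otimes> (y \<otimes> inv x \<otimes> inv y) \<in> M" using M assms by auto
  then have "x \<otimes> y \<otimes> inv x \<otimes> inv y \<in> M" using c by (simp add: m_assoc)
  with 1 assms(4) have "x \<otimes> y \<otimes> inv x \<otimes> inv y = \<one>" by auto
  then have "x \<otimes> y \<otimes> inv x = y" using c
    by (metis inv_closed inv_equality inv_inv m_closed)
  then show ?thesis using c by (metis inv_closed inv_solve_right m_closed)
qed

section \<open>Morphisms, images, preimages and kernels\<close>

lemma omorD:
  assumes "omor Om G G' f"
  shows "\<And>x. x \<in> carrier G \<Longrightarrow> f x \<in> carrier G'"
    "\<And>x y. x \<in> carrier G \<Longrightarrow> y \<in> carrier G \<Longrightarrow> f (x \<otimes>\<^bsub>G\<^esub> y) = f x \<otimes>\<^bsub>G'\<^esub> f y"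
    "\<And>w x. w \<in> Om \<Longrightarrow> x \<in> carrier G \<Longrightarrow> f (opr G w x) = opr G' w (f x)"
  using assms by (auto simp: omor_def hom_def)

lemma omor_one: "ogroup Om G \<Longrightarrow> ogroup Om G' \<Longrightarrow> omor Om G G' f \<Longrightarrow> f \<one>\<^bsub>G\<^esub> = \<one>\<^bsub>G'\<^esub>"
  by (auto simp: omor_def ogroup_group intro: hom_one)

lemma omor_inv:
  "ogroup Om G \<Longrightarrow> ogroup Om G' \<Longrightarrow> omor Om G G' f \<Longrightarrow> x \<in> carrier G \<Longrightarrow>
    f (inv\<^bsub>G\<^esub> x) = inv\<^bsub>G'\<^esub> (f x)"
  by (rule group_hom.hom_inv) (auto simp: group_hom_def group_hom_axioms_def ogroup_group omor_def)

lemma omor_comp: "omor Om G G' f \<Longrightarrow> omor Om G' G'' g \<Longrightarrow> omor Om G G'' (\<lambda>x. g (f x))"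
  by (auto simp: omor_def hom_def Pi_iff)

lemma omor_osub:
  "omor Om G G' f \<Longrightarrow> H \<subseteq> carrier G \<Longrightarrow> f ` H \<subseteq> H' \<Longrightarrow> omor Om (osub G H) (osub G' H') f"
  by (auto simp: omor_def hom_def Pi_iff subset_iff)

lemma omor_from_osub: "omor Om K (osub G A) f \<Longrightarrow> A \<subseteq> carrier G \<Longrightarrow> omor Om K G f"
  by (auto simp: omor_def hom_def)

lemma omor_into_osub: "omor Om K G f \<Longrightarrow> f ` carrier K \<subseteq> A \<Longrightarrow> omor Om K (osub G A) f"
  by (auto simp: omor_def hom_def)

lemma omor_restrict:
  "ogroup Om G \<Longrightarrow> omor Om G G' f \<Longrightarrow> omor Om G G' (restrict f (carrier G))"
  using group.is_monoid[OF ogroup_group] by (auto simp: omor_def hom_def opr_closed monoid.m_closed)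

text \<open>Only plain subgroups appear here: the result feeds
  \<open>ogen_Union_subset_subgroup\<close>, whose test set may fail to be operator-stable.\<close>

lemma omor_preimage:
  assumes "ogroup Om G" "ogroup Om G'" "omor Om G G' f" "subgroup Y G'"
  shows "subgroup {x \<in> carrier G. f x \<in> Y} G"
proof -
  interpret group G by (rule ogroup_group[OF assms(1)])
  show ?thesis
    using omorD[OF assms(3)] omor_one[OF assms(1-3)] omor_inv[OF assms(1-3)]
      subgroup.m_closed[OF assms(4)] subgroup.one_closed[OF assms(4)] subgroup.m_inv_closed[OF assms(4)]
    by (intro subgroup.intro) auto
qed

text \<open>Turns equality of two morphisms into a subgroup condition that can be tested on
  generators.\<close>

lemma omor_equalizer:
  assumes "ogroup Om G" "ogroup Om G'" "omor Om G G' f" "omor Om G G' g"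
  shows "subgroup {x \<in> carrier G. f x = g x} G"
proof -
  interpret group G by (rule ogroup_group[OF assms(1)])
  show ?thesis
    using omorD[OF assms(3)] omor_one[OF assms(1-3)] omor_inv[OF assms(1-3)]
     omorD[OF assms(4)] omor_one[OF assms(1,2,4)] omor_inv[OF assms(1,2,4)]
    by (intro subgroup.intro) auto
qed

lemma omor_image_osubgroup:
  assumes "ogroup Om G" "ogroup Om G'" "omor Om G G' f" "osubgroup Om N G"
  shows "osubgroup Om (f ` N) G'"
proof -
  note N = osubgroupD[OF assms(4)]
  note f = omorD[OF assms(3)] omor_one[OF assms(1-3)] omor_inv[OF assms(1-3)]
  have "subgroup (f ` N) G'"
  proof (unfold_locales, goal_cases)
    case 1 then show ?case using f(1) N(2) by auto
  next
    case (2 x y)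
    then obtain a b where "a \<in> N" "b \<in> N" "x = f a" "y = f b" by blast
    then show ?case using f(2)[of a b] N by (metis image_eqI subsetD)
  next
    case 3 then show ?case using f(4) N(3) by (metis image_eqI)
  next
    case (4 x)
    then obtain a where "a \<in> N" "x = f a" by blast
    then show ?case using f(5)[of a] N by (metis image_eqI subsetD)
  qed
  moreover have "opr G' w x \<in> f ` N" if "w \<in> Om" "x \<in> f ` N" for w x
  proof -
    from that obtain a where "a \<in> N" "x = f a" by blast
    then show ?thesis using f(3)[of w a] N that by (metis image_eqI subsetD)
  qed
  ultimately show ?thesis by (simp add: osubgroup_def)
qed

text \<open>Surjectivity lets every conjugating element of \<open>G'\<close> be lifted to
  \<open>G\<close>; the image of a normal subgroup under an arbitrary morphism need not be
  normal.\<close>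

lemma omor_image_onormal_onto:
  fixes G :: "('w, 'a) omonoid" (structure)
  assumes "ogroup Om G" "ogroup Om G'" "omor Om G G' f" "f ` carrier G = carrier G'" "onormal Om N G"
  shows "onormal Om (f ` N) G'"
proof -
  have N: "osubgroup Om N G" "\<And>g n. g \<in> carrier G \<Longrightarrow> n \<in> N \<Longrightarrow> g \<otimes>\<^bsub>G\<^esub> n \<otimes>\<^bsub>G\<^esub> inv\<^bsub>G\<^esub> g \<in> N"
    using assms by (auto simp: onormal_iff)
  interpret group G by (rule ogroup_group[OF assms(1)])
  have "g' \<otimes>\<^bsub>G'\<^esub> n' \<otimes>\<^bsub>G'\<^esub> inv\<^bsub>G'\<^esub> g' \<in> f ` N" if "g' \<in> carrier G'" "n' \<in> f ` N" for g' n'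
  proof -
    from that obtain g n where gn: "g \<in> carrier G" "n \<in> N" "g' = f g" "n' = f n"
      using assms(4) by (metis image_iff)
    moreover have "n \<in> carrier G" using gn osubgroupD(2)[OF N(1)] by auto
    ultimately have "g' \<otimes>\<^bsub>G'\<^esub> n' \<otimes>\<^bsub>G'\<^esub> inv\<^bsub>G'\<^esub> g' = f (g \<otimes> n \<otimes> inv g)"
      using omorD[OF assms(3)] omor_inv[OF assms(1-3)] by simp
    then show ?thesis using N(2) gn by blast
  qed
  then show ?thesis using omor_image_osubgroup[OF assms(1-3) N(1)] by (simp add: onormal_iff assms(2))
qed

lemma omor_ker_onormal:
  assumes "ogroup Om G" "ogroup Om G'" "omor Om G G' f"
  shows "onormal Om {x \<in> carrier G. f x = \<one>\<^bsub>G'\<^esub>} G"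
proof -
  interpret group G by (rule ogroup_group[OF assms(1)])
  interpret G': group G' by (rule ogroup_group[OF assms(2)])
  have "subgroup {x \<in> carrier G. f x \<in> {\<one>\<^bsub>G'\<^esub>}} G"
    by (rule omor_preimage[OF assms]) (rule G'.triv_subgroup)
  then show ?thesis
    using assms omorD[OF assms(3)] omor_inv[OF assms]
    by (auto simp: onormal_iff osubgroup_def opr_closed opr_one)
qed

section \<open>Isomorphisms and simple \<Omega>-groups\<close>

lemma oiso_refl: "ogroup Om G \<Longrightarrow> oiso Om G G"
  unfolding oiso_def omor_def by (auto intro!: exI[of _ "\<lambda>x. x"] simp: hom_def bij_betw_def)

lemma omor_inv_into:
  fixes G :: "('w, 'a) omonoid" (structure)
  assumes G: "ogroup Om G" "ogroup Om G'" and f: "omor Om G G' f" "bij_betw f (carrier G) (carrier G')"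
  shows "omor Om G' G (inv_into (carrier G) f)"
proof -
  interpret group G by (rule ogroup_group[OF G(1)])
  define g where "g = inv_into (carrier G) f"
  have gc: "g y \<in> carrier G" if "y \<in> carrier G'" for y
    using f(2) that unfolding g_def by (metis bij_betw_def inv_into_into)
  have fg: "f (g y) = y" if "y \<in> carrier G'" for y
    using f(2) that unfolding g_def by (metis bij_betw_def f_inv_into_f)
  have inj: "inj_on f (carrier G)" using f(2) by (simp add: bij_betw_def)
  have gm: "g (x \<otimes>\<^bsub>G'\<^esub> y) = g x \<otimes> g y" if "x \<in> carrier G'" "y \<in> carrier G'" for x y
    using that gc fg omorD[OF f(1)] G group.is_monoid[OF ogroup_group[OF G(2)]]
    by (intro inj_onD[OF inj]) (auto simp: monoid.m_closed)
  have go: "g (opr G' w x) = opr G w (g x)" if "x \<in> carrier G'" "w \<in> Om" for x w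
    using that gc fg omorD[OF f(1)] G by (intro inj_onD[OF inj]) (auto simp: opr_closed)
  show ?thesis using gc gm go unfolding omor_def hom_def g_def by blast
qed

lemma oiso_sym: "oiso Om G G' \<Longrightarrow> oiso Om G' G"
  unfolding oiso_def using omor_inv_into bij_betw_inv_into by blast

lemma oiso_trans:
  assumes "oiso Om G G'" "oiso Om G' G''" shows "oiso Om G G''"
proof -
  obtain f g where "omor Om G G' f" "bij_betw f (carrier G) (carrier G')"
    "omor Om G' G'' g" "bij_betw g (carrier G') (carrier G'')"
    using assms by (auto simp: oiso_def)
  then have "omor Om G G'' (\<lambda>x. g (f x))" "bij_betw (\<lambda>x. g (f x)) (carrier G) (carrier G'')"
    using omor_comp bij_betw_trans[of f _ _ g] by (auto simp: comp_def)
  then show ?thesis using assms by (auto simp: oiso_def)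
qed

text \<open>A normal subgroup of \<open>G'\<close> is carried to \<open>G\<close> by the inverse
  isomorphism, which is onto and so preserves normality; injectivity then recovers the subgroup from
  its image.\<close>

lemma oiso_osimple:
  assumes "oiso Om G G'" "osimple Om G" shows "osimple Om G'"
proof -
  from oiso_sym[OF assms(1)] obtain g where g: "omor Om G' G g" "bij_betw g (carrier G') (carrier G)"
    and G: "ogroup Om G" "ogroup Om G'" by (auto simp: oiso_def)
  have inj: "inj_on g (carrier G')" and im: "g ` carrier G' = carrier G"
    using g(2) by (auto simp: bij_betw_def)
  have one: "\<one>\<^bsub>G'\<^esub> \<in> carrier G'" "g \<one>\<^bsub>G'\<^esub> = \<one>\<^bsub>G\<^esub>"
    using osubgroupD(3)[OF osubgroup_carrier[OF G(2)]] omor_one[OF G(2,1) g(1)] by auto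
  have "carrier G' \<noteq> {\<one>\<^bsub>G'\<^esub>}" using assms(2) im one by (auto simp: osimple_def)
  moreover have "N = {\<one>\<^bsub>G'\<^esub>} \<or> N = carrier G'" if N: "onormal Om N G'" for N
  proof -
    have sub: "N \<subseteq> carrier G'" using osubgroupD(2)[OF onormal_osubgroup[OF N]] .
    have "g ` N = {\<one>\<^bsub>G\<^esub>} \<or> g ` N = carrier G"
      using omor_image_onormal_onto[OF G(2,1) g(1) im N] assms(2) by (simp add: osimple_def)
    then have "g ` N = g ` {\<one>\<^bsub>G'\<^esub>} \<or> g ` N = g ` carrier G'" using one im by simp
    then show ?thesis using inj_on_image_eq_iff[OF inj sub] one(1) by auto
  qed
  ultimately show ?thesis using G by (simp add: osimple_def)
qed

text \<open>The kernel is a normal \<Omega>-subgroup of a simple group: either it is everything and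
  the image is trivial, or it is trivial and \<open>f\<close> is injective.\<close>

lemma osimple_image:
  assumes "osimple Om S" "ogroup Om G" "omor Om S G f"
  shows "f ` carrier S = {\<one>\<^bsub>G\<^esub>} \<or> oiso Om S (osub G (f ` carrier S))"
proof -
  have S: "ogroup Om S" using assms by (simp add: osimple_def)
  interpret S: group S by (rule ogroup_group[OF S])
  interpret G: group G by (rule ogroup_group[OF assms(2)])
  let ?K = "{x \<in> carrier S. f x = \<one>\<^bsub>G\<^esub>}"
  have "?K = {\<one>\<^bsub>S\<^esub>} \<or> ?K = carrier S"
    using omor_ker_onormal[OF S assms(2,3)] assms(1) by (simp add: osimple_def)
  then show ?thesis
  proof
    assume "?K = carrier S"
    then have "f x = \<one>\<^bsub>G\<^esub>" if "x \<in> carrier S" for x using that by blast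
    then have "f ` carrier S = {\<one>\<^bsub>G\<^esub>}" using S.one_closed by force
    then show ?thesis ..
  next
    assume K: "?K = {\<one>\<^bsub>S\<^esub>}"
    have "group_hom S G f"
      using assms(3) by (simp add: group_hom_def group_hom_axioms_def omor_def)
    moreover have "kernel S G f = {\<one>\<^bsub>S\<^esub>}" using K by (simp add: kernel_def)
    ultimately have "inj_on f (carrier S)" by (metis group_hom.trivial_ker_imp_inj)
    moreover have "omor Om S (osub G (f ` carrier S)) f"
      using omor_osub[OF assms(3), of "carrier S" "f ` carrier S"] by simp
    moreover have "ogroup Om (osub G (f ` carrier S))"
      using osub_ogroup[OF assms(2)] omor_image_osubgroup[OF S assms(2,3) osubgroup_carrier[OF S]] .
    ultimately have "oiso Om S (osub G (f ` carrier S))" using S by (auto simp: oiso_def bij_betw_def)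
    then show ?thesis ..
  qed
qed

lemma osimple_osub_image:
  assumes "ogroup Om G" "ogroup Om G'" "omor Om G G' f" "H \<subseteq> carrier G" "osimple Om (osub G H)"
  shows "f ` H = {\<one>\<^bsub>G'\<^esub>} \<or> oiso Om (osub G H) (osub G' (f ` H)) \<and> osimple Om (osub G' (f ` H))"
proof -
  have "omor Om (osub G H) G' f"
    using omor_osub[OF assms(3,4), of "carrier G'"] omorD(1)[OF assms(3)] assms(4) by auto
  from osimple_image[OF assms(5,2) this] show ?thesis
    using oiso_osimple[OF _ assms(5)] by auto
qed

section \<open>Generated \<Omega>-subgroups\<close>

lemma Union_osubgroup_generate:
  assumes "ogroup Om G" "\<And>F. F \<in> \<F> \<Longrightarrow> osubgroup Om F G"
  shows "osubgroup Om (generate G (\<Union>\<F>)) G"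
proof -
  interpret group G by (rule ogroup_group[OF assms(1)])
  have sub: "\<Union>\<F> \<subseteq> carrier G" using assms(2) osubgroupD(2) by blast
  have "opr G w x \<in> generate G (\<Union>\<F>)" if "x \<in> generate G (\<Union>\<F>)" "w \<in> Om" for w x
    using that(1)
  proof (induction rule: generate.induct)
    case one then show ?case by (simp add: opr_one[OF assms(1) that(2)] generate.one)
  next
    case (incl h)
    then show ?case using osubgroupD(6)[OF assms(2)] that(2) by (blast intro: generate.incl)
  next
    case (inv h)
    then have "opr G w h \<in> \<Union>\<F>" "h \<in> carrier G" using osubgroupD(6)[OF assms(2)] that(2) sub by blast+
    then show ?case by (simp add: opr_inv[OF assms(1) that(2)] generate.inv)
  next
    case (eng h1 h2)
    then show ?case using generate_in_carrier[OF sub]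
      by (simp add: opr_mult[OF assms(1) that(2)] generate.eng)
  qed
  then show ?thesis using generate_is_subgroup[OF sub] by (simp add: osubgroup_def)
qed

lemma ogen_incl: "A \<subseteq> ogen Om G A"
  by (auto simp: ogen_def)

lemma ogen_least: "osubgroup Om Y G \<Longrightarrow> A \<subseteq> Y \<Longrightarrow> ogen Om G A \<subseteq> Y"
  by (auto simp: ogen_def)

lemma ogen_mono: "A \<subseteq> B \<Longrightarrow> ogen Om G A \<subseteq> ogen Om G B"
  by (auto simp: ogen_def)

lemma ogen_osubgroup:
  assumes "ogroup Om G" "A \<subseteq> carrier G"
  shows "osubgroup Om (ogen Om G A) G"
proof -
  interpret group G by (rule ogroup_group[OF assms(1)])
  have "subgroup (ogen Om G A) G" unfolding ogen_def
    using osubgroup_carrier[OF assms(1)] assms(2)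
    by (intro subgroups_Inter) (auto simp: osubgroup_def)
  then show ?thesis by (auto simp: osubgroup_def ogen_def)
qed

text \<open>The generation principle behind most later arguments. Operators are endomorphisms
  mapping each member of the family into itself, so \<open>generate\<close> is already
  operator-stable, and \<open>Y\<close> may be any plain subgroup, such as a centraliser.\<close>

lemma ogen_Union_subset_subgroup:
  assumes "ogroup Om G" "\<And>F. F \<in> \<F> \<Longrightarrow> osubgroup Om F G" "subgroup Y G" "\<And>F. F \<in> \<F> \<Longrightarrow> F \<subseteq> Y"
  shows "ogen Om G (\<Union>\<F>) \<subseteq> Y"
proof -
  interpret group G by (rule ogroup_group[OF assms(1)])
  have "ogen Om G (\<Union>\<F>) \<subseteq> generate G (\<Union>\<F>)"
    by (rule ogen_least[OF Union_osubgroup_generate]) (auto intro: assms generate.incl)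
  also have "\<dots> \<subseteq> Y" using assms(3,4) by (intro generate_subgroup_incl) auto
  finally show ?thesis .
qed

lemma ogen_Union_onormal:
  fixes G :: "('w, 'a) omonoid" (structure)
  assumes "ogroup Om G" "\<And>F. F \<in> \<F> \<Longrightarrow> onormal Om F G"
  shows "onormal Om (ogen Om G (\<Union>\<F>)) G"
proof -
  interpret group G by (rule ogroup_group[OF assms(1)])
  let ?N = "ogen Om G (\<Union>\<F>)"
  have F: "osubgroup Om F G" if "F \<in> \<F>" for F using assms(2)[OF that] onormal_osubgroup by blast
  have N: "osubgroup Om ?N G" using F osubgroupD(2) by (intro ogen_osubgroup[OF assms(1)]) blast
  have "g \<otimes> n \<otimes> inv g \<in> ?N" if g: "g \<in> carrier G" and n: "n \<in> ?N" for g n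
  proof -
    \<comment> \<open>Preimage of \<open>?N\<close> under conjugation by \<open>g\<close>.
      Conjugation need not commute with the operators, so \<open>?Y\<close> is handled as a plain
      subgroup.\<close>
    let ?Y = "{x \<in> carrier G. g \<otimes> x \<otimes> inv g \<in> ?N}"
    have "subgroup ?Y G"
    proof (unfold_locales, goal_cases)
      case (2 x y)
      then have "(g \<otimes> x \<otimes> inv g) \<otimes> (g \<otimes> y \<otimes> inv g) \<in> ?N" using osubgroupD(4)[OF N] by blast
      moreover have "(g \<otimes> x \<otimes> inv g) \<otimes> (g \<otimes> y \<otimes> inv g) = g \<otimes> (x \<otimes> y) \<otimes> inv g"
        using 2 g by (simp add: m_assoc inv_solve_left')
      ultimately show ?case using 2 by auto
    next
      case 3 then show ?case using g osubgroupD(3)[OF N] by simp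
    next
      case (4 x)
      then have "inv (g \<otimes> x \<otimes> inv g) \<in> ?N" using osubgroupD(5)[OF N] by blast
      moreover have "inv (g \<otimes> x \<otimes> inv g) = g \<otimes> inv x \<otimes> inv g"
        using 4 g by (simp add: inv_mult_group m_assoc)
      ultimately show ?case using 4 by auto
    qed auto
    moreover have "F \<subseteq> ?Y" if "F \<in> \<F>" for F
    proof -
      have "F \<subseteq> ?N" using ogen_incl[of "\<Union>\<F>" Om G] that by blast
      then show ?thesis
        using assms(2)[OF that] g that osubgroupD(2)[OF F[OF that]] by (auto simp: onormal_iff[OF assms(1)])
    qed
    ultimately show ?thesis using ogen_Union_subset_subgroup[OF assms(1) F, of \<F> ?Y] n by auto
  qed
  then show ?thesis using N by (simp add: onormal_iff assms(1))
qed

lemma ogen_osub: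
  assumes "ogroup Om G" "osubgroup Om H G" "A \<subseteq> H"
  shows "ogen Om (osub G H) A = ogen Om G A"
proof
  have A: "A \<subseteq> carrier G" using assms osubgroupD(2) by blast
  have "osubgroup Om (ogen Om G A) G" "ogen Om G A \<subseteq> H"
    using ogen_osubgroup[OF assms(1) A] ogen_least[OF assms(2,3)] .
  then show "ogen Om (osub G H) A \<subseteq> ogen Om G A"
    by (intro ogen_least ogen_incl) (simp add: osubgroup_osub_iff[OF assms(1,2)])
  have "osubgroup Om (ogen Om (osub G H) A) (osub G H)"
    using ogen_osubgroup[OF osub_ogroup[OF assms(1,2)]] assms(3) by simp
  then show "ogen Om G A \<subseteq> ogen Om (osub G H) A"
    by (intro ogen_least ogen_incl) (simp add: osubgroup_osub_iff[OF assms(1,2)])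
qed

text \<open>The normaliser need not be stable under the operators, so the generation by a family
  of \<open>\<Omega>\<close>-subgroups has to be exploited through plain subgroups.\<close>
lemma onormal_by_generators:
  fixes G :: "('w, 'a) omonoid" (structure)
  assumes "ogroup Om G" "carrier G = ogen Om G (\<Union>\<F>)" "\<And>F. F \<in> \<F> \<Longrightarrow> osubgroup Om F G"
    and N: "osubgroup Om N G"
    and conj_closed: "\<And>F g n. F \<in> \<F> \<Longrightarrow> g \<in> F \<Longrightarrow> n \<in> N \<Longrightarrow> g \<otimes>\<^bsub>G\<^esub> n \<otimes>\<^bsub>G\<^esub> inv\<^bsub>G\<^esub> g \<in> N"
  shows "onormal Om N G"
proof -
  interpret group G by (rule ogroup_group[OF assms(1)])
  have Nc: "n \<in> carrier G" if "n \<in> N" for n using osubgroupD(2)[OF N] that by blast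
  \<comment> \<open>Both \<open>g\<close> and its inverse are required to conjugate \<open>N\<close>
    into itself, which makes closure under inverses a matter of symmetry.\<close>
  let ?Y = "{g \<in> carrier G. \<forall>n\<in>N. g \<otimes> n \<otimes> inv g \<in> N \<and> inv g \<otimes> n \<otimes> g \<in> N}"
  have "subgroup ?Y G"
  proof (unfold_locales, goal_cases)
    case (2 x y)
    have "x \<otimes> y \<otimes> n \<otimes> inv (x \<otimes> y) = x \<otimes> (y \<otimes> n \<otimes> inv y) \<otimes> inv x"
      "inv (x \<otimes> y) \<otimes> n \<otimes> (x \<otimes> y) = inv y \<otimes> (inv x \<otimes> n \<otimes> x) \<otimes> y" if "n \<in> N" for n
      using 2 Nc[OF that] by (auto simp: inv_mult_group m_assoc)
    then show ?case using 2 by auto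
  next
    case 3 then show ?case using Nc by simp
  qed auto
  moreover have "F \<subseteq> ?Y" if F: "F \<in> \<F>" for F
  proof
    fix g assume g: "g \<in> F"
    then have "inv g \<in> F" "g \<in> carrier G" using osubgroupD[OF assms(3)[OF F]] by auto
    then show "g \<in> ?Y" using conj_closed[OF F g] conj_closed[OF F \<open>inv g \<in> F\<close>] by auto
  qed
  ultimately have "carrier G \<subseteq> ?Y"
    using ogen_Union_subset_subgroup[OF assms(1,3), of \<F> ?Y] assms(2) by simp
  then show ?thesis using N by (auto simp: onormal_iff assms(1))
qed

section \<open>Complements and isomorphism types in the socle\<close>

lemma ZsetD:
  assumes "H \<in> Zset Om G"
  shows "onormal Om H G" "osubgroup Om H G" "osimple Om (osub G H)" "H \<subseteq> carrier G" "H \<noteq> {\<one>\<^bsub>G\<^esub>}"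
    "ogroup Om (osub G H)"
  using assms osubgroupD(2)[of Om H G]
  by (auto simp: Zset_def osimple_def dest: onormal_osubgroup)

text \<open>A subgroup of \<open>H\<close> that is normal in \<open>G\<close> is normal in
  \<open>H\<close>, where simplicity leaves only two candidates.\<close>

lemma Zset_minimal:
  assumes "ogroup Om G" "H \<in> Zset Om G" "onormal Om N G" "N \<subseteq> H" "N \<noteq> {\<one>\<^bsub>G\<^esub>}"
  shows "N = H"
  using onormal_osub[OF assms(1,3) ZsetD(2)[OF assms(2)] assms(4)] ZsetD(3)[OF assms(2)] assms(5)
  by (auto simp: osimple_def)

lemma Zset_Int_onormal:
  assumes "ogroup Om G" "H \<in> Zset Om G" "onormal Om N G"
  shows "H \<inter> N = {\<one>\<^bsub>G\<^esub>} \<or> H \<subseteq> N"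
  using Zset_minimal[OF assms(1,2) onormal_Int[OF assms(1) ZsetD(1)[OF assms(2)] assms(3)]] by auto

lemma Zset_commute:
  assumes "ogroup Om G" "H \<in> Zset Om G" "K \<in> Zset Om G" "H \<noteq> K" "x \<in> H" "y \<in> K"
  shows "x \<otimes>\<^bsub>G\<^esub> y = y \<otimes>\<^bsub>G\<^esub> x"
proof (rule onormal_Int_one_commute[OF assms(1) ZsetD(1)[OF assms(2)] ZsetD(1)[OF assms(3)] _ assms(5,6)])
  show "H \<inter> K = {\<one>\<^bsub>G\<^esub>}"
    using Zset_Int_onormal[OF assms(1,2) ZsetD(1)[OF assms(3)]] assms(4)
      Zset_minimal[OF assms(1,3) ZsetD(1)[OF assms(2)]] ZsetD(5)[OF assms(2)] by blast
qed

text \<open>Normality of the image is a hypothesis because a morphism need not preserve it;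
  simplicity of the image is automatic once it is nontrivial.\<close>

lemma Zset_image:
  assumes "ogroup Om G" "ogroup Om G'" "omor Om G G' f" "H \<in> Zset Om G" "onormal Om (f ` H) G'"
    "f ` H \<noteq> {\<one>\<^bsub>G'\<^esub>}"
  shows "f ` H \<in> Zset Om G'" "oiso Om (osub G H) (osub G' (f ` H))"
  using osimple_osub_image[OF assms(1-3) ZsetD(4,3)[OF assms(4)]] assms(5,6) by (auto simp: Zset_def)

text \<open>Simplicity carries over verbatim because \<open>osub (osub G L) H\<close> is
  \<open>osub G H\<close>; only normality has to be relativised.\<close>

lemma Zset_osub:
  assumes "ogroup Om G" "osubgroup Om L G" "H \<in> Zset Om G" "H \<subseteq> L"
  shows "H \<in> Zset Om (osub G L)"
  using assms by (auto simp: Zset_def onormal_osub)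

section \<open>Complements of normal subgroups and the retractions they give\<close>

lemma onormal_set_mult:
  fixes G :: "('w, 'a) omonoid" (structure)
  assumes "ogroup Om G" "onormal Om M G" "onormal Om N G"
  shows "onormal Om (M <#> N) G"
proof -
  interpret group G by (rule ogroup_group[OF assms(1)])
  note M = osubgroupD[OF onormal_osubgroup[OF assms(2)]]
  note N = osubgroupD[OF onormal_osubgroup[OF assms(3)]]
  have "subgroup (M <#> N) G"
    by (rule mult_norm_subgroup) (use assms N in \<open>auto simp: onormal_def\<close>)
  moreover have "opr G w x \<in> M <#> N" if "w \<in> Om" "x \<in> M <#> N" for w x
  proof -
    from that(2) obtain m n where mn: "m \<in> M" "n \<in> N" "x = m \<otimes> n" by (auto simp: set_mult_def)
    then have "opr G w x = opr G w m \<otimes> opr G w n" using M(2) N(2) by (auto intro!: opr_mult assms that)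
    then show ?thesis using M(6)[OF that(1) mn(1)] N(6)[OF that(1) mn(2)] by (auto simp: set_mult_def)
  qed
  moreover have "M <#> N \<lhd> G"
    by (rule normal_subgroup_set_mult_closed) (use assms in \<open>auto simp: onormal_def\<close>)
  ultimately show ?thesis by (simp add: onormal_def osubgroup_def)
qed

lemma set_mult_one_right:
  assumes "group G" "M \<subseteq> carrier G" "\<one>\<^bsub>G\<^esub> \<in> N" shows "M \<subseteq> M <#>\<^bsub>G\<^esub> N"
proof
  fix x assume "x \<in> M"
  moreover from this have "x = x \<otimes>\<^bsub>G\<^esub> \<one>\<^bsub>G\<^esub>"
    using assms(2) by (simp add: monoid.r_one[OF group.is_monoid[OF assms(1)]] subset_iff)
  ultimately show "x \<in> M <#>\<^bsub>G\<^esub> N" using assms(3) unfolding set_mult_def by blast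
qed

lemma set_mult_one_left:
  assumes "group G" "M \<subseteq> carrier G" "\<one>\<^bsub>G\<^esub> \<in> N" shows "M \<subseteq> N <#>\<^bsub>G\<^esub> M"
proof
  fix x assume "x \<in> M"
  moreover from this have "x = \<one>\<^bsub>G\<^esub> \<otimes>\<^bsub>G\<^esub> x"
    using assms(2) by (simp add: monoid.l_one[OF group.is_monoid[OF assms(1)]] subset_iff)
  ultimately show "x \<in> N <#>\<^bsub>G\<^esub> M" using assms(3) unfolding set_mult_def by blast
qed

text \<open>The generating family is a parameter because two cases are needed: a semisimple group
  with all of its own \<open>Zset\<close>, and the socle of \<open>G\<close> with
  \<open>Zset Om G\<close>, which may be smaller than the \<open>Zset\<close> of the socle.\<close>

definition zgen :: "'w set \<Rightarrow> ('w, 'a) omonoid \<Rightarrow> 'a set set \<Rightarrow> bool" where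
  "zgen Om G \<F> \<longleftrightarrow> ogroup Om G \<and> \<F> \<subseteq> Zset Om G \<and> carrier G = ogen Om G (\<Union>\<F>)"

lemma zgenD:
  assumes "zgen Om G \<F>"
  shows "ogroup Om G" "\<And>F. F \<in> \<F> \<Longrightarrow> F \<in> Zset Om G" "\<And>F. F \<in> \<F> \<Longrightarrow> osubgroup Om F G"
    "carrier G = ogen Om G (\<Union>\<F>)"
  using assms ZsetD(2) by (auto simp: zgen_def)

lemma zgen_carrier_subset:
  assumes "zgen Om G \<F>" "subgroup Y G" "\<And>F. F \<in> \<F> \<Longrightarrow> F \<subseteq> Y"
  shows "carrier G \<subseteq> Y"
  using ogen_Union_subset_subgroup[OF zgenD(1,3)[OF assms(1)] assms(2,3)] zgenD(4)[OF assms(1)] by simp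

lemma chain_Union_onormal:
  assumes "ogroup Om G" "C \<noteq> {}" "subset.chain {N. onormal Om N G} C"
  shows "onormal Om (\<Union>C) G"
proof -
  have C: "osubgroup Om N G" "onormal Om N G" if "N \<in> C" for N
    using that assms(3) onormal_osubgroup by (auto simp: subset.chain_def)
  have tot: "M \<subseteq> N \<or> N \<subseteq> M" if "M \<in> C" "N \<in> C" for M N
    using that assms(3) by (auto simp: subset.chain_def)
  have "subgroup (\<Union>C) G"
  proof (rule subgroup.intro, goal_cases)
    case 1 then show ?case using osubgroupD(2)[OF C(1)] by blast
  next
    case (2 x y)
    then obtain M N where MN: "M \<in> C" "N \<in> C" "x \<in> M" "y \<in> N" by blast
    then show ?case using tot[OF MN(1,2)] osubgroupD(4)[OF C(1)] by blast
  next
    case 3 then show ?case using assms(2) osubgroupD(3)[OF C(1)] by blast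
  next
    case (4 x) then show ?case using osubgroupD(5)[OF C(1)] by blast
  qed
  moreover have "opr G w x \<in> \<Union>C" if "w \<in> Om" "x \<in> \<Union>C" for w x
    using that osubgroupD(6)[OF C(1)] by blast
  moreover have "g \<otimes>\<^bsub>G\<^esub> n \<otimes>\<^bsub>G\<^esub> inv\<^bsub>G\<^esub> g \<in> \<Union>C" if "g \<in> carrier G" "n \<in> \<Union>C" for g n
    using that C(2) unfolding onormal_iff[OF assms(1)] by blast
  ultimately show ?thesis by (simp add: onormal_iff[OF assms(1)] osubgroup_def)
qed

text \<open>\<open>P\<close> is maximal among the normal subgroups that meet \<open>N\<close>
  trivially. A generator \<open>F\<close> outside \<open>N <#> P\<close> would meet that product
  trivially, and \<open>P <#> F\<close> would be a larger competitor.\<close>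

lemma zgen_complement:
  fixes G :: "('w, 'a) omonoid" (structure)
  assumes "zgen Om G \<F>" "onormal Om N G"
  shows "\<exists>P. onormal Om P G \<and> N \<inter> P = {\<one>} \<and> N <#> P = carrier G"
proof -
  note G = zgenD[OF assms(1)]
  interpret group G by (rule ogroup_group[OF G(1)])
  note N = osubgroupD[OF onormal_osubgroup[OF assms(2)]]
  let ?A = "{P. onormal Om P G \<and> N \<inter> P = {\<one>}}"
  have "\<exists>P\<in>?A. \<forall>Q\<in>?A. P \<subseteq> Q \<longrightarrow> Q = P"
  proof (rule subset_Zorn_nonempty)
    show "?A \<noteq> {}" using onormal_one[OF G(1)] N(3) by auto
  next
    fix C assume C: "C \<noteq> {}" "subset.chain ?A C"
    then have "onormal Om (\<Union>C) G"
      by (intro chain_Union_onormal[OF G(1)]) (auto simp: subset.chain_def)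
    moreover have "N \<inter> Q = {\<one>}" if "Q \<in> C" for Q using C that by (auto simp: subset.chain_def)
    then have "N \<inter> \<Union>C = {\<one>}" using C(1) by blast
    ultimately show "\<Union>C \<in> ?A" by simp
  qed
  then obtain P where P: "onormal Om P G" "N \<inter> P = {\<one>}"
    and max: "\<And>Q. onormal Om Q G \<Longrightarrow> N \<inter> Q = {\<one>} \<Longrightarrow> P \<subseteq> Q \<Longrightarrow> Q = P" by auto
  note P' = osubgroupD[OF onormal_osubgroup[OF P(1)]]
  have NP: "onormal Om (N <#> P) G" by (rule onormal_set_mult[OF G(1) assms(2) P(1)])
  note NP' = osubgroupD[OF onormal_osubgroup[OF NP]]
  have "F \<subseteq> N <#> P" if F: "F \<in> \<F>" for F
  proof (rule ccontr)
    assume "\<not> F \<subseteq> N <#> P"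
    then have int: "F \<inter> (N <#> P) = {\<one>}" using Zset_Int_onormal[OF G(1) G(2)[OF F] NP] by blast
    note Fo = ZsetD[OF G(2)[OF F]]
    have Fi: "\<one> \<in> F" using osubgroupD(3)[OF Fo(2)] .
    \<comment> \<open>If \<open>x = p \<otimes> h\<close> lies in \<open>N\<close>, then
      \<open>h\<close> is the inverse of \<open>p\<close> times \<open>x\<close>. As
      \<open>N\<close> and \<open>P\<close> commute, \<open>h\<close> lies in \<open>N <#> P\<close>
      as well as in \<open>F\<close>, so it is trivial and \<open>x = p\<close> lies in
      \<open>N \<inter> P\<close>.\<close>
    have "N \<inter> (P <#> F) \<subseteq> {\<one>}"
    proof
      fix x assume "x \<in> N \<inter> (P <#> F)"
      then obtain p h where x: "x \<in> N" "p \<in> P" "h \<in> F" "x = p \<otimes> h" by (auto simp: set_mult_def)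
      have c: "x \<in> carrier G" "p \<in> carrier G" "h \<in> carrier G" using x N(2) P'(2) Fo(4) by auto
      have "h = inv p \<otimes> x" using x c by (simp add: inv_solve_left)
      also have "\<dots> = x \<otimes> inv p"
        using onormal_Int_one_commute[OF G(1) assms(2) P(1,2) x(1) P'(5)[OF x(2)]] by simp
      also have "\<dots> \<in> N <#> P" using x(1) P'(5)[OF x(2)] by (auto simp: set_mult_def)
      finally have "h = \<one>" using int x(3) by auto
      then have "x = p" using x c by simp
      then show "x \<in> {\<one>}" using P(2) x by auto
    qed
    moreover have PF: "onormal Om (P <#> F) G" by (rule onormal_set_mult[OF G(1) P(1) Fo(1)])
    ultimately have "N \<inter> (P <#> F) = {\<one>}" using N(3) osubgroupD(3)[OF onormal_osubgroup[OF PF]] by auto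
    moreover have "P \<subseteq> P <#> F" using set_mult_one_right[OF ogroup_group[OF G(1)] P'(2) Fi] .
    \<comment> \<open>Maximality puts \<open>F\<close> inside \<open>P\<close>, hence inside
      \<open>N <#> P\<close>, which it meets trivially; so \<open>F\<close> would be
      trivial.\<close>
    ultimately have "P <#> F = P" using max[OF PF] by simp
    moreover have "F \<subseteq> P <#> F" using set_mult_one_left[OF ogroup_group[OF G(1)] Fo(4) P'(3)] .
    moreover have "P \<subseteq> N <#> P" using set_mult_one_left[OF ogroup_group[OF G(1)] P'(2) N(3)] .
    ultimately have "F \<subseteq> N <#> P" by simp
    then have "F = {\<one>}" using int by auto
    then show False using Fo(5) by simp
  qed
  then have "carrier G \<subseteq> N <#> P" by (rule zgen_carrier_subset[OF assms(1) NP'(1)])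
  then show ?thesis using P NP'(2) by blast
qed

text \<open>Projection of a direct decomposition onto the factor \<open>N\<close>. The normality
  clause makes the image of a member of \<open>Zset\<close> either trivial or again a member of
  \<open>Zset\<close>. The kernel is not recorded and is supplied separately where it
  matters.\<close>

definition nretr :: "'w set \<Rightarrow> ('w, 'a) omonoid \<Rightarrow> 'a set \<Rightarrow> ('a \<Rightarrow> 'a) \<Rightarrow> bool" where
  "nretr Om G N p \<longleftrightarrow> omor Om G G p \<and> p ` carrier G = N \<and> (\<forall>n\<in>N. p n = n) \<and>
    (\<forall>M. onormal Om M G \<longrightarrow> onormal Om (p ` M) G)"

text \<open>Projection along \<open>P\<close>: the decomposition is unique because \<open>N\<close>
  and \<open>P\<close> meet trivially, and dropping the \<open>P\<close>-part is multiplicative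
  because the two factors commute.\<close>

lemma complement_nretr:
  fixes G :: "('w, 'a) omonoid" (structure)
  assumes "ogroup Om G" "onormal Om N G" "onormal Om P G" "N \<inter> P = {\<one>}" "N <#> P = carrier G"
  shows "\<exists>p. nretr Om G N p \<and> {x \<in> carrier G. p x = \<one>} = P"
proof -
  interpret group G by (rule ogroup_group[OF assms(1)])
  note N = osubgroupD[OF onormal_osubgroup[OF assms(2)]]
  note P = osubgroupD[OF onormal_osubgroup[OF assms(3)]]
  define p where "p x = (THE n. n \<in> N \<and> (\<exists>q\<in>P. x = n \<otimes> q))" for x
  have pnq: "p (n \<otimes> q) = n" if "n \<in> N" "q \<in> P" for n q
    unfolding p_def
  proof (rule the_equality)
    fix n' assume "n' \<in> N \<and> (\<exists>q'\<in>P. n \<otimes> q = n' \<otimes> q')"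
    then obtain q' where n': "n' \<in> N" "q' \<in> P" "n \<otimes> q = n' \<otimes> q'" by blast
    have c: "n \<in> carrier G" "q \<in> carrier G" "n' \<in> carrier G" "q' \<in> carrier G"
      using that n' N(2) P(2) by auto
    have "inv n' \<otimes> n = q' \<otimes> inv q"
      using n'(3) c by (metis inv_closed inv_solve_left inv_solve_right m_assoc m_closed)
    moreover have "inv n' \<otimes> n \<in> N" "q' \<otimes> inv q \<in> P" using that n' N P by auto
    ultimately have "inv n' \<otimes> n \<in> N \<inter> P" by simp
    then have "inv n' \<otimes> n = \<one>" using assms(4) by auto
    then show "n' = n" using c by (metis inv_closed inv_equality inv_inv)
  qed (use that in auto)
  have dec: "\<exists>n\<in>N. \<exists>q\<in>P. x = n \<otimes> q" if "x \<in> carrier G" for x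
    using that unfolding assms(5)[symmetric] by (auto simp: set_mult_def)
  have comm: "n \<otimes> q = q \<otimes> n" if "n \<in> N" "q \<in> P" for n q
    using onormal_Int_one_commute[OF assms(1-4) that] .
  have pN: "p n = n" if "n \<in> N" for n using pnq[OF that P(3)] that N(2) by auto
  have mult: "p (x \<otimes> y) = p x \<otimes> p y" if xy: "x \<in> carrier G" "y \<in> carrier G" for x y
  proof -
    obtain n q m r where 1: "n \<in> N" "q \<in> P" "x = n \<otimes> q" "m \<in> N" "r \<in> P" "y = m \<otimes> r"
      using dec[OF xy(1)] dec[OF xy(2)] by blast
    have c: "n \<in> carrier G" "q \<in> carrier G" "m \<in> carrier G" "r \<in> carrier G"
      using 1 N(2) P(2) by auto
    have "x \<otimes> y = n \<otimes> (q \<otimes> m) \<otimes> r" using 1 c by (simp add: m_assoc)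
    also have "\<dots> = (n \<otimes> m) \<otimes> (q \<otimes> r)" using comm[OF 1(4,2)] c by (metis m_assoc m_closed)
    finally show ?thesis
      unfolding 1(3,6) pnq[OF 1(1,2)] pnq[OF 1(4,5)] using pnq[OF N(4)[OF 1(1,4)] P(4)[OF 1(2,5)]] by simp
  qed
  have opr: "p (opr G w x) = opr G w (p x)" if xw: "x \<in> carrier G" "w \<in> Om" for w x
  proof -
    obtain n q where 1: "n \<in> N" "q \<in> P" "x = n \<otimes> q" using dec[OF xw(1)] by blast
    have c: "n \<in> carrier G" "q \<in> carrier G" using 1 N(2) P(2) by auto
    have "p (opr G w n \<otimes> opr G w q) = opr G w n"
      by (rule pnq[OF N(6)[OF that(2) 1(1)] P(6)[OF that(2) 1(2)]])
    then show ?thesis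
      unfolding 1(3) opr_mult[OF assms(1) that(2) c] pnq[OF 1(1,2)] .
  qed
  have pc: "p x \<in> N" if "x \<in> carrier G" for x using dec[OF that] pnq by auto
  have mor: "omor Om G G p" using mult opr pc N(2) by (auto simp: omor_def hom_def)
  \<comment> \<open>The \<open>P\<close>-part \<open>q\<close> of \<open>g\<close> commutes with
    \<open>p m\<close>, so only the \<open>N\<close>-part conjugates it. Hence \<open>p\<close> is
    equivariant under conjugation by all of \<open>G\<close>, and this is what makes it
    normal.\<close>
  have equi: "g \<otimes> p m \<otimes> inv g = p (g \<otimes> m \<otimes> inv g)" if gm: "g \<in> carrier G" "m \<in> carrier G" for g m
  proof -
    obtain n q where 1: "n \<in> N" "q \<in> P" "g = n \<otimes> q" using dec[OF gm(1)] by blast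
    have c: "n \<in> carrier G" "q \<in> carrier G" "p m \<in> carrier G" using 1 N(2) P(2) pc gm by auto
    have "g \<otimes> p m \<otimes> inv g = n \<otimes> (q \<otimes> p m) \<otimes> inv q \<otimes> inv n"
      using c by (simp add: 1(3) m_assoc inv_mult_group)
    also have "\<dots> = n \<otimes> p m \<otimes> (q \<otimes> inv q) \<otimes> inv n"
      unfolding comm[OF pc[OF gm(2)] 1(2), symmetric] using c by (simp add: m_assoc del: r_inv)
    also have "\<dots> = n \<otimes> p m \<otimes> inv n" using c by simp
    also have "\<dots> = p g \<otimes> p m \<otimes> inv (p g)" using pnq 1 by simp
    also have "\<dots> = p (g \<otimes> m \<otimes> inv g)" using omorD(2)[OF mor] omor_inv[OF assms(1,1) mor] gm by simp
    finally show ?thesis .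
  qed
  have "onormal Om (p ` M) G" if M: "onormal Om M G" for M
  proof -
    have Ms: "osubgroup Om M G" "M \<subseteq> carrier G" using M osubgroupD(2) onormal_osubgroup by blast+
    have "g \<otimes> x \<otimes> inv g \<in> p ` M" if "g \<in> carrier G" "x \<in> p ` M" for g x
    proof -
      from that obtain m where m: "m \<in> M" "x = p m" by blast
      then have "g \<otimes> x \<otimes> inv g = p (g \<otimes> m \<otimes> inv g)" using equi that Ms by auto
      moreover have "g \<otimes> m \<otimes> inv g \<in> M" using M m that by (auto simp: onormal_iff assms(1))
      ultimately show ?thesis by simp
    qed
    then show ?thesis using omor_image_osubgroup[OF assms(1,1) mor Ms(1)]
      by (simp add: onormal_iff assms(1))
  qed
  moreover have "p ` carrier G = N" using pc pN N(2) by force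
  moreover have "{x \<in> carrier G. p x = \<one>} = P"
  proof (intro equalityI subsetI)
    fix x assume "x \<in> {x \<in> carrier G. p x = \<one>}"
    then have x: "x \<in> carrier G" "p x = \<one>" by auto
    obtain n q where 1: "n \<in> N" "q \<in> P" "x = n \<otimes> q" using dec[OF x(1)] by blast
    then have "n = \<one>" using pnq x by auto
    then show "x \<in> P" using 1 P(2) by auto
  next
    fix q assume q: "q \<in> P"
    have "p (\<one> \<otimes> q) = \<one>" by (rule pnq[OF N(3) q])
    then show "q \<in> {x \<in> carrier G. p x = \<one>}" using q P(2) by auto
  qed
  ultimately show ?thesis using mor pN by (auto simp: nretr_def)
qed

lemma zgen_nretr:
  assumes "zgen Om G \<F>" "onormal Om N G"
  shows "\<exists>p. nretr Om G N p"
  using zgen_complement[OF assms] complement_nretr[OF zgenD(1)[OF assms(1)] assms(2)] by blast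

text \<open>A retraction with kernel \<open>N\<close> stands in for the quotient map by
  \<open>N\<close> while its values stay inside \<open>G\<close>. It comes from exchanging the roles
  of \<open>N\<close> and its complement.\<close>

lemma zgen_nretr_ker:
  fixes G :: "('w, 'a) omonoid" (structure)
  assumes "zgen Om G \<F>" "onormal Om N G"
  shows "\<exists>P p. nretr Om G P p \<and> {x \<in> carrier G. p x = \<one>} = N"
proof -
  interpret group G by (rule ogroup_group[OF zgenD(1)[OF assms(1)]])
  obtain P where P: "onormal Om P G" "N \<inter> P = {\<one>}" "N <#> P = carrier G"
    using zgen_complement[OF assms] by blast
  have "P <#> N = N <#> P"
    by (rule commut_normal) (use P(1) assms(2) in \<open>auto simp: onormal_def osubgroup_def\<close>)
  then show ?thesis
    using complement_nretr[OF zgenD(1)[OF assms(1)] P(1) assms(2)] P by (metis inf_commute)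
qed

section \<open>Isomorphism types inside a group generated by simple normal subgroups\<close>

lemma Zset_onto_some:
  fixes G :: "('w, 'a) omonoid" (structure)
  assumes "ogroup Om G" "\<H> \<subseteq> Zset Om G" "omor Om G G f"
    "\<And>M. onormal Om M G \<Longrightarrow> onormal Om (f ` M) G"
    "K \<in> Zset Om G" "f ` carrier G \<subseteq> K" "x \<in> ogen Om G (\<Union>\<H>)" "f x \<noteq> \<one>"
  shows "\<exists>H\<in>\<H>. f ` H = K \<and> oiso Om (osub G H) (osub G K)"
proof -
  interpret group G by (rule ogroup_group[OF assms(1)])
  have hs: "osubgroup Om H G" if "H \<in> \<H>" for H using that assms(2) ZsetD(2) by blast
  \<comment> \<open>If every member were killed, the kernel would contain the subgroup they
    generate, and \<open>x\<close> with it. A member that survives has a nontrivial normal image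
    inside the minimal \<open>K\<close>, so it covers \<open>K\<close>.\<close>
  have "\<exists>H\<in>\<H>. f ` H \<noteq> {\<one>}"
  proof (rule ccontr)
    assume neg: "\<not> (\<exists>H\<in>\<H>. f ` H \<noteq> {\<one>})"
    have "subgroup {x \<in> carrier G. f x \<in> {\<one>}} G"
      by (rule omor_preimage[OF assms(1,1,3) triv_subgroup])
    moreover have "H \<subseteq> {x \<in> carrier G. f x \<in> {\<one>}}" if "H \<in> \<H>" for H
      using neg that ZsetD(4)[of H Om G] assms(2) by blast
    ultimately have "ogen Om G (\<Union>\<H>) \<subseteq> {x \<in> carrier G. f x \<in> {\<one>}}"
      using hs by (intro ogen_Union_subset_subgroup[OF assms(1)])
    then show False using assms(7,8) by auto
  qed
  then obtain H where H: "H \<in> \<H>" "f ` H \<noteq> {\<one>}" by blast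
  then have HZ: "H \<in> Zset Om G" using assms(2) by auto
  have n: "onormal Om (f ` H) G" by (rule assms(4)[OF ZsetD(1)[OF HZ]])
  have "f ` H = K"
    using Zset_minimal[OF assms(1,5) n _ H(2)] ZsetD(4)[OF HZ] assms(6) by blast
  then show ?thesis using Zset_image(2)[OF assms(1,1,3) HZ n H(2)] H(1) by auto
qed

lemma osubgroup_nontrivial:
  assumes "osubgroup Om H G" "H \<noteq> {\<one>\<^bsub>G\<^esub>}"
  obtains x where "x \<in> H" "x \<noteq> \<one>\<^bsub>G\<^esub>"
  using assms osubgroupD(3) by blast

text \<open>A retraction onto \<open>K\<close> fixes a nontrivial element of \<open>K\<close>, which
  lies in the subgroup generated by \<open>\<H>\<close>; so some member of \<open>\<H>\<close> is
  mapped isomorphically onto \<open>K\<close>.\<close>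

lemma Zset_in_ogen_iso:
  assumes "zgen Om G \<F>" "\<H> \<subseteq> Zset Om G" "K \<in> Zset Om G" "K \<subseteq> ogen Om G (\<Union>\<H>)"
  shows "\<exists>H\<in>\<H>. oiso Om (osub G H) (osub G K)"
proof -
  obtain p where p: "nretr Om G K p" using zgen_nretr[OF assms(1) ZsetD(1)[OF assms(3)]] by blast
  obtain x where "x \<in> K" "x \<noteq> \<one>\<^bsub>G\<^esub>" using osubgroup_nontrivial ZsetD(2,5)[OF assms(3)] by metis
  then show ?thesis
    using Zset_onto_some[OF zgenD(1)[OF assms(1)] assms(2), of p K x] p assms(3,4)
    by (auto simp: nretr_def)
qed

text \<open>\<open>K\<close> need not belong to \<open>\<F>\<close>, so the members of type
  \<open>S\<close> in the generating family must be shown to swallow it. The reason is that no copy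
  of \<open>S\<close> survives modulo the subgroup \<open>?N\<close> they generate.\<close>

lemma Zset_subset_ogen_iso:
  assumes "zgen Om G \<F>" "K \<in> Zset Om G" "oiso Om (osub G K) S"
  shows "K \<subseteq> ogen Om G (\<Union>{H \<in> \<F>. oiso Om (osub G H) S})" (is "K \<subseteq> ?N")
proof -
  note G = zgenD[OF assms(1)]
  have N: "onormal Om ?N G" using ZsetD(1)[OF G(2)] by (intro ogen_Union_onormal[OF G(1)]) blast
  obtain P q where q: "nretr Om G P q" "{x \<in> carrier G. q x = \<one>\<^bsub>G\<^esub>} = ?N"
    using zgen_nretr_ker[OF assms(1) N] by blast
  show ?thesis
  proof (cases "q ` K = {\<one>\<^bsub>G\<^esub>}")
    case True
    then show ?thesis using q(2) ZsetD(4)[OF assms(2)] by blast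
  next
    case False
    have qm: "omor Om G G q" "\<And>M. onormal Om M G \<Longrightarrow> onormal Om (q ` M) G"
      using q by (auto simp: nretr_def)
    have K2: "q ` K \<in> Zset Om G" "oiso Om (osub G K) (osub G (q ` K))"
      using Zset_image[OF G(1,1) qm(1) assms(2) qm(2)[OF ZsetD(1)[OF assms(2)]] False] by auto
    \<comment> \<open>\<open>r\<close> compresses the values of \<open>q\<close> to the single
      simple group that is the image of \<open>K\<close>, so the composite of \<open>q\<close> and
      \<open>r\<close> has a minimal target.\<close>
    obtain r where r: "nretr Om G (q ` K) r" using zgen_nretr[OF assms(1) ZsetD(1)[OF K2(1)]] by blast
    obtain x where x: "x \<in> K" "q x \<noteq> \<one>\<^bsub>G\<^esub>"
      using osubgroup_nontrivial ZsetD(2,5)[OF K2(1)] by (metis imageE)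
    have rq: "r (q x) = q x" using r x by (auto simp: nretr_def)
    have "\<exists>F\<in>\<F>. (\<lambda>y. r (q y)) ` F = q ` K \<and> oiso Om (osub G F) (osub G (q ` K))"
    proof (rule Zset_onto_some[OF G(1) _ _ _ K2(1)])
      show "\<F> \<subseteq> Zset Om G" using G(2) by blast
      show "omor Om G G (\<lambda>y. r (q y))" using omor_comp qm(1) r by (auto simp: nretr_def)
      show "onormal Om ((\<lambda>y. r (q y)) ` M) G" if "onormal Om M G" for M
        using qm(2)[OF that] r by (auto simp: nretr_def image_image[symmetric])
      show "(\<lambda>y. r (q y)) ` carrier G \<subseteq> q ` K" using r omorD(1)[OF qm(1)] by (auto simp: nretr_def)
      show "x \<in> ogen Om G (\<Union>\<F>)" using x(1) ZsetD(4)[OF assms(2)] G(4) by blast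
      show "r (q x) \<noteq> \<one>\<^bsub>G\<^esub>" using rq x by simp
    qed
    then obtain F where F: "F \<in> \<F>" "(\<lambda>y. r (q y)) ` F = q ` K" "oiso Om (osub G F) (osub G (q ` K))"
      by blast
    \<comment> \<open>\<open>F\<close> has type \<open>S\<close>, so it lies in the kernel
      \<open>?N\<close> of \<open>q\<close>; yet the composite maps it onto the nontrivial image of
      \<open>K\<close>.\<close>
    have "oiso Om (osub G F) S"
      using F(3) K2(2) assms(3) oiso_sym oiso_trans by metis
    then have "F \<subseteq> ?N" using F(1) ogen_incl[of "\<Union>{H \<in> \<F>. oiso Om (osub G H) S}" Om G] by blast
    then have "q y = \<one>\<^bsub>G\<^esub>" if "y \<in> F" for y using q(2) that by blast
    then have "(\<lambda>y. r (q y)) ` F \<subseteq> {r \<one>\<^bsub>G\<^esub>}" by auto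
    moreover have "r \<one>\<^bsub>G\<^esub> = \<one>\<^bsub>G\<^esub>" using omor_one[OF G(1,1)] r by (auto simp: nretr_def)
    ultimately have "q ` K \<subseteq> {\<one>\<^bsub>G\<^esub>}" using F(2) by simp
    then show ?thesis using x by auto
  qed
qed

lemma zgen_onormal_ogen:
  assumes "zgen Om G \<F>" "onormal Om N G"
  shows "N = ogen Om G (\<Union>{K \<in> Zset Om G. K \<subseteq> N})" (is "N = ?R")
proof
  note G = zgenD[OF assms(1)]
  show "?R \<subseteq> N" by (rule ogen_least[OF onormal_osubgroup[OF assms(2)]]) auto
  obtain p where p: "nretr Om G N p" using zgen_nretr[OF assms] by blast
  then have pm: "omor Om G G p" "\<And>M. onormal Om M G \<Longrightarrow> onormal Om (p ` M) G"
    by (auto simp: nretr_def)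
  have R: "osubgroup Om ?R G" using ZsetD(4) by (intro ogen_osubgroup[OF G(1)]) blast
  \<comment> \<open>Each generator goes to the trivial group or to a member of \<open>Zset\<close>
    inside \<open>N\<close>, so the preimage of \<open>?R\<close> under \<open>p\<close> is
    everything. As \<open>p\<close> fixes \<open>N\<close> pointwise, \<open>N\<close> lies in
    \<open>?R\<close>.\<close>
  have "carrier G \<subseteq> {x \<in> carrier G. p x \<in> ?R}"
  proof (rule zgen_carrier_subset[OF assms(1) omor_preimage[OF G(1,1) pm(1) osubgroupD(1)[OF R]]])
    fix F assume "F \<in> \<F>"
    then have F: "F \<in> Zset Om G" using G(2) by blast
    have "p ` F \<subseteq> ?R"
    proof (cases "p ` F = {\<one>\<^bsub>G\<^esub>}")
      case True then show ?thesis using osubgroupD(3)[OF R] by simp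
    next
      case False
      have "p ` F \<in> Zset Om G" using Zset_image(1)[OF G(1,1) pm(1) F pm(2)[OF ZsetD(1)[OF F]] False] .
      moreover have "p ` F \<subseteq> N" using p ZsetD(4)[OF F] by (auto simp: nretr_def)
      ultimately show ?thesis using ogen_incl[of "\<Union>{K \<in> Zset Om G. K \<subseteq> N}" Om G] by blast
    qed
    then show "F \<subseteq> {x \<in> carrier G. p x \<in> ?R}" using ZsetD(4)[OF F] by blast
  qed
  moreover have "p n = n" "n \<in> carrier G" if "n \<in> N" for n
    using p that osubgroupD(2)[OF onormal_osubgroup[OF assms(2)]] by (auto simp: nretr_def)
  ultimately show "N \<subseteq> ?R" by fastforce
qed

section \<open>The socle, isotypic components and supports\<close>

lemma soc_osubgroup: "ogroup Om G \<Longrightarrow> osubgroup Om (soc Om G) G"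
  unfolding soc_def using ZsetD(4) by (intro ogen_osubgroup) blast+

lemma Zset_subset_soc: "H \<in> Zset Om G \<Longrightarrow> H \<subseteq> soc Om G"
  unfolding soc_def using ogen_incl[of "\<Union>(Zset Om G)" Om G] by blast

lemma Gcomp_eq: "Gcomp Om G S = ogen Om G (\<Union>{H \<in> Zset Om G. oiso Om (osub G H) S})"
  by (simp add: Gcomp_def compC_def)

lemma Gcomp_onormal: "ogroup Om G \<Longrightarrow> onormal Om (Gcomp Om G S) G"
  unfolding Gcomp_eq using ZsetD(1) by (intro ogen_Union_onormal) blast+

lemma Zset_subset_Gcomp: "H \<in> Zset Om G \<Longrightarrow> oiso Om (osub G H) S \<Longrightarrow> H \<subseteq> Gcomp Om G S"
  unfolding Gcomp_eq using ogen_incl[of "\<Union>{H \<in> Zset Om G. oiso Om (osub G H) S}" Om G] by blast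

lemma zgen_soc:
  assumes "ogroup Om G"
  shows "zgen Om (osub G (soc Om G)) (Zset Om G)"
proof -
  note so = soc_osubgroup[OF assms]
  have "ogen Om (osub G (soc Om G)) (\<Union>(Zset Om G)) = ogen Om G (\<Union>(Zset Om G))"
    using Zset_subset_soc by (intro ogen_osub[OF assms so]) blast
  then show ?thesis
    using osub_ogroup[OF assms so] Zset_osub[OF assms so _ Zset_subset_soc]
    by (auto simp: zgen_def soc_def)
qed

lemma isoclass_eq: "oiso Om H K \<Longrightarrow> isoclass Om H = isoclass Om K"
  unfolding isoclass_def using oiso_sym oiso_trans by blast

lemma Supp_subset:
  assumes "\<And>K. K \<in> Zset Om G \<Longrightarrow> \<exists>H\<in>Zset Om G'. oiso Om (osub G' H) (osub G K)"
  shows "Supp Om G \<subseteq> Supp Om G'"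
proof
  fix C assume "C \<in> Supp Om G"
  then obtain K where K: "K \<in> Zset Om G" "C = isoclass Om (osub G K)" by (auto simp: Supp_def)
  then obtain H where "H \<in> Zset Om G'" "oiso Om (osub G' H) (osub G K)" using assms by blast
  then show "C \<in> Supp Om G'" using K(2) isoclass_eq unfolding Supp_def by blast
qed

text \<open>A simple normal subgroup of the socle need not be normal in \<open>G\<close>, so the two
  generating sets can differ. Those of type \<open>S\<close> still lie in the subgroup generated by
  the ones that come from \<open>G\<close>.\<close>

lemma Gcomp_soc:
  assumes "ogroup Om G"
  shows "Gcomp Om (osub G (soc Om G)) S = Gcomp Om G S"
proof -
  note so = soc_osubgroup[OF assms]
  let ?L = "osub G (soc Om G)"
  note z = zgen_soc[OF assms]
  let ?A = "\<Union>{H \<in> Zset Om G. oiso Om (osub G H) S}"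
  have A: "?A \<subseteq> soc Om G" using Zset_subset_soc by blast
  have eq: "ogen Om ?L ?A = Gcomp Om G S" unfolding Gcomp_eq by (rule ogen_osub[OF assms so A])
  have "Gcomp Om ?L S \<subseteq> ogen Om ?L ?A" unfolding Gcomp_eq
  proof (rule ogen_least)
    show "osubgroup Om (ogen Om ?L ?A) ?L"
      using A by (intro ogen_osubgroup osub_ogroup assms so) simp
    show "\<Union>{H \<in> Zset Om ?L. oiso Om (osub ?L H) S} \<subseteq> ogen Om ?L ?A"
      using Zset_subset_ogen_iso[OF z, of _ S] by auto
  qed
  moreover have "ogen Om ?L ?A \<subseteq> Gcomp Om ?L S" unfolding Gcomp_eq
    using zgenD(2)[OF z] by (intro ogen_mono) auto
  ultimately show ?thesis using eq by simp
qed

text \<open>The generators coming from \<open>G\<close> already represent every type of simple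
  normal subgroup of the socle.\<close>

lemma Supp_soc:
  assumes "ogroup Om G"
  shows "Supp Om (osub G (soc Om G)) = Supp Om G"
proof -
  let ?L = "osub G (soc Om G)"
  note z = zgen_soc[OF assms]
  have "\<exists>H\<in>Zset Om G. oiso Om (osub G H) (osub G K)" if K: "K \<in> Zset Om ?L" for K
    using Zset_in_ogen_iso[OF z _ K, of "Zset Om G"] zgenD(2,4)[OF z] ZsetD(4)[OF K]
    by (metis osub_simps(5) subsetI)
  then have "Supp Om ?L \<subseteq> Supp Om G" by (intro Supp_subset) simp
  moreover have "Supp Om G \<subseteq> Supp Om ?L"
    unfolding Supp_def using zgenD(2)[OF z] by auto
  ultimately show ?thesis by blast
qed

section \<open>Products of commuting morphisms\<close>

text \<open>In a noncommutative group, a finite product is independent of the order of its factors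
  as soon as they commute pairwise; this is the condition under which \<open>gprod\<close> is
  used.\<close>

definition commfam :: "('a, 'm) monoid_scheme \<Rightarrow> 'i set \<Rightarrow> ('i \<Rightarrow> 'a) \<Rightarrow> bool" where
  "commfam G I u \<longleftrightarrow> (\<forall>i\<in>I. u i \<in> carrier G) \<and>
    (\<forall>i\<in>I. \<forall>j\<in>I. i \<noteq> j \<longrightarrow> u i \<otimes>\<^bsub>G\<^esub> u j = u j \<otimes>\<^bsub>G\<^esub> u i)"

text \<open>The guard makes the folded operations commute on the whole type, as
  \<^const>\<open>comp_fun_commute_on\<close> demands.\<close>
definition gprod :: "('a, 'm) monoid_scheme \<Rightarrow> 'i set \<Rightarrow> ('i \<Rightarrow> 'a) \<Rightarrow> 'a" where
  "gprod G F u = Finite_Set.fold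
    (\<lambda>i a. if u i \<in> carrier G \<and> a \<in> carrier G then u i \<otimes>\<^bsub>G\<^esub> a else a) \<one>\<^bsub>G\<^esub> F"

lemma gprod_cong: "(\<And>i. i \<in> F \<Longrightarrow> u i = v i) \<Longrightarrow> gprod G F u = gprod G F v"
  unfolding gprod_def by (intro Finite_Set.fold_closed_eq[where B = UNIV]) auto

context group begin

lemma gprod_empty [simp]: "gprod G {} u = \<one>"
  by (simp add: gprod_def)

lemma gprod_fold_commute:
  assumes "commfam G I u"
  shows "comp_fun_commute_on I (\<lambda>i a. if u i \<in> carrier G \<and> a \<in> carrier G then u i \<otimes> a else a)"
proof
  fix i j assume ij: "i \<in> I" "j \<in> I"
  have "u j \<otimes> (u i \<otimes> a) = u i \<otimes> (u j \<otimes> a)" if "a \<in> carrier G" for a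
  proof (cases "i = j")
    case False
    then show ?thesis using assms ij that unfolding commfam_def by (metis m_assoc)
  qed simp
  then show "(\<lambda>a. if u j \<in> carrier G \<and> a \<in> carrier G then u j \<otimes> a else a) \<circ>
      (\<lambda>a. if u i \<in> carrier G \<and> a \<in> carrier G then u i \<otimes> a else a) =
    (\<lambda>a. if u i \<in> carrier G \<and> a \<in> carrier G then u i \<otimes> a else a) \<circ>
      (\<lambda>a. if u j \<in> carrier G \<and> a \<in> carrier G then u j \<otimes> a else a)"
    by (auto simp: fun_eq_iff)
qed

lemma gprod_closed:
  assumes "commfam G I u" "finite F" "F \<subseteq> I"
  shows "gprod G F u \<in> carrier G"
  using assms(2,3)
proof (induction F)
  case (insert i F)
  then show ?case using comp_fun_commute_on.fold_insert[OF gprod_fold_commute[OF assms(1)], of i F]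
    by (simp add: gprod_def)
qed simp

lemma gprod_insert:
  assumes "commfam G I u" "finite F" "insert i F \<subseteq> I" "i \<notin> F"
  shows "gprod G (insert i F) u = u i \<otimes> gprod G F u"
proof -
  have "gprod G F u \<in> carrier G" "u i \<in> carrier G"
    using gprod_closed[OF assms(1,2)] assms by (auto simp: commfam_def)
  then show ?thesis
    using comp_fun_commute_on.fold_insert[OF gprod_fold_commute[OF assms(1)] assms(3,2,4)]
    by (simp add: gprod_def)
qed

lemma gprod_ones:
  assumes "commfam G I u" "finite D" "finite F" "F \<union> D \<subseteq> I" "F \<inter> D = {}" "\<And>i. i \<in> D \<Longrightarrow> u i = \<one>"
  shows "gprod G (F \<union> D) u = gprod G F u"
  using assms(2,4-)
proof (induction D)
  case (insert i D)
  have "gprod G (F \<union> insert i D) u = u i \<otimes> gprod G (F \<union> D) u"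
    using gprod_insert[OF assms(1), of "F \<union> D" i] insert assms(3) by simp
  then show ?case using insert gprod_closed[OF assms(1,3)] by simp
qed simp

text \<open>Lets products with different supports be compared over one common finite index
  set.\<close>

lemma gprod_superset:
  assumes "commfam G I u" "finite F'" "F \<subseteq> F'" "F' \<subseteq> I" "\<And>i. i \<in> F' - F \<Longrightarrow> u i = \<one>"
  shows "gprod G F' u = gprod G F u"
proof -
  have "F \<union> (F' - F) = F'" using assms by auto
  then show ?thesis
    using gprod_ones[OF assms(1), of "F' - F" F] assms finite_subset[OF assms(3,2)] by auto
qed

lemma gprod_commute:
  assumes "commfam G I u" "finite F" "F \<subseteq> I" "x \<in> carrier G" "\<And>i. i \<in> F \<Longrightarrow> x \<otimes> u i = u i \<otimes> x"
  shows "x \<otimes> gprod G F u = gprod G F u \<otimes> x"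
  using assms(2,3,5)
proof (induction F)
  case (insert i F)
  have c: "u i \<in> carrier G" "gprod G F u \<in> carrier G"
    using assms(1) insert gprod_closed[OF assms(1)] by (auto simp: commfam_def)
  have "x \<otimes> (u i \<otimes> gprod G F u) = u i \<otimes> (x \<otimes> gprod G F u)"
    using c assms(4) insert.prems(2)[of i] by (simp add: m_assoc[symmetric])
  also have "\<dots> = u i \<otimes> gprod G F u \<otimes> x" using c assms(4) insert by (simp add: m_assoc)
  finally show ?case using gprod_insert[OF assms(1)] insert by simp
qed (simp add: assms)

text \<open>The induction moves \<open>v i\<close> past the product of the remaining
  \<open>u j\<close>. Within one index the order of \<open>u i\<close> and \<open>v i\<close> is
  kept.\<close>

lemma gprod_mult:
  assumes "commfam G I u" "commfam G I v" "commfam G I (\<lambda>i. u i \<otimes> v i)" "finite F" "F \<subseteq> I"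
    "\<And>i j. i \<in> I \<Longrightarrow> j \<in> I \<Longrightarrow> i \<noteq> j \<Longrightarrow> v i \<otimes> u j = u j \<otimes> v i"
  shows "gprod G F (\<lambda>i. u i \<otimes> v i) = gprod G F u \<otimes> gprod G F v"
  using assms(4,5)
proof (induction F)
  case (insert i F)
  have c: "u i \<in> carrier G" "v i \<in> carrier G" "gprod G F u \<in> carrier G" "gprod G F v \<in> carrier G"
    using assms(1,2) insert gprod_closed[OF assms(1)] gprod_closed[OF assms(2)] by (auto simp: commfam_def)
  have vc: "v i \<otimes> gprod G F u = gprod G F u \<otimes> v i"
  proof (rule gprod_commute[OF assms(1) insert(1) _ c(2)])
    show "v i \<otimes> u j = u j \<otimes> v i" if "j \<in> F" for j
      using that insert by (intro assms(6)) auto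
  qed (use insert in simp)
  have "gprod G (insert i F) (\<lambda>i. u i \<otimes> v i) = u i \<otimes> v i \<otimes> (gprod G F u \<otimes> gprod G F v)"
    using gprod_insert[OF assms(3)] insert by simp
  also have "\<dots> = u i \<otimes> (v i \<otimes> gprod G F u) \<otimes> gprod G F v" using c by (simp add: m_assoc)
  also have "\<dots> = (u i \<otimes> gprod G F u) \<otimes> (v i \<otimes> gprod G F v)" using c by (simp add: vc m_assoc)
  finally show ?case using gprod_insert[OF assms(1)] gprod_insert[OF assms(2)] insert by simp
qed simp

lemma gprod_hom:
  assumes "h \<in> hom G G" "commfam G I u" "commfam G I (\<lambda>i. h (u i))" "finite F" "F \<subseteq> I"
  shows "gprod G F (\<lambda>i. h (u i)) = h (gprod G F u)"
  using assms(4,5)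
proof (induction F)
  case empty
  then show ?case using hom_one[OF assms(1)] group_axioms by simp
next
  case (insert i F)
  then have "u i \<in> carrier G" "gprod G F u \<in> carrier G"
    using assms(2) gprod_closed[OF assms(2)] by (auto simp: commfam_def)
  then show ?case
    using gprod_insert[OF assms(2)] gprod_insert[OF assms(3)] insert assms(1) by (simp add: hom_mult)
qed

end

text \<open>The common source of \<open>theta\<close> (with coordinate maps as \<open>t\<close>) and
  of the inverse of \<Phi>. Values are recorded only where at most one factor is nontrivial; the
  last clause also covers elements killed by all factors when \<open>I\<close> is empty.\<close>

lemma omor_product_exists:
  fixes G :: "('w, 'a) omonoid" (structure) and K :: "('w, 'b) omonoid"
  assumes K: "ogroup Om K" and G: "ogroup Om G"
    and t: "\<And>i. i \<in> I \<Longrightarrow> omor Om K G (t i)"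
    and comm: "\<And>i j x y. i \<in> I \<Longrightarrow> j \<in> I \<Longrightarrow> i \<noteq> j \<Longrightarrow> x \<in> carrier K \<Longrightarrow> y \<in> carrier K \<Longrightarrow>
      t i x \<otimes> t j y = t j y \<otimes> t i x"
    and fin: "\<And>x. x \<in> carrier K \<Longrightarrow> finite {i \<in> I. t i x \<noteq> \<one>}"
  shows "\<exists>f. omor Om K G f \<and>
    (\<forall>x\<in>carrier K. \<forall>i\<in>I. (\<forall>j\<in>I. j \<noteq> i \<longrightarrow> t j x = \<one>) \<longrightarrow> f x = t i x) \<and>
    (\<forall>x\<in>carrier K. (\<forall>j\<in>I. t j x = \<one>) \<longrightarrow> f x = \<one>)"
proof -
  interpret group G by (rule ogroup_group[OF G])
  interpret K: group K by (rule ogroup_group[OF K])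
  define f where "f x = gprod G {i \<in> I. t i x \<noteq> \<one>} (\<lambda>i. t i x)" for x
  have cf: "commfam G I (\<lambda>i. t i x)" if "x \<in> carrier K" for x
    using omorD(1)[OF t] comm that by (auto simp: commfam_def)
  have fF: "f x = gprod G F (\<lambda>i. t i x)"
    if "x \<in> carrier K" "finite F" "F \<subseteq> I" "{i \<in> I. t i x \<noteq> \<one>} \<subseteq> F" for x F
    unfolding f_def using that(2-) by (intro gprod_superset[OF cf[OF that(1)], symmetric]) auto
  have "f (x \<otimes>\<^bsub>K\<^esub> y) = f x \<otimes> f y" if xy: "x \<in> carrier K" "y \<in> carrier K" for x y
  proof -
    \<comment> \<open>The factors that are nontrivial at \<open>x\<close>, at \<open>y\<close> and
      at their product have different index sets, so all three products are taken over the union of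
      the first two.\<close>
    let ?F = "{i \<in> I. t i x \<noteq> \<one>} \<union> {i \<in> I. t i y \<noteq> \<one>}"
    have F: "finite ?F" "?F \<subseteq> I" using fin xy by auto
    have tm: "t i (x \<otimes>\<^bsub>K\<^esub> y) = t i x \<otimes> t i y" if "i \<in> I" for i
      using omorD(2)[OF t[OF that]] xy by simp
    have cm: "commfam G I (\<lambda>i. t i x \<otimes> t i y)"
      using cf[of "x \<otimes>\<^bsub>K\<^esub> y"] xy tm by (simp add: commfam_def)
    have "f (x \<otimes>\<^bsub>K\<^esub> y) = gprod G {i \<in> I. t i (x \<otimes>\<^bsub>K\<^esub> y) \<noteq> \<one>} (\<lambda>i. t i (x \<otimes>\<^bsub>K\<^esub> y))"
      by (simp add: f_def)
    also have "\<dots> = gprod G ?F (\<lambda>i. t i (x \<otimes>\<^bsub>K\<^esub> y))"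
      using F xy tm by (intro gprod_superset[OF cf, symmetric]) auto
    also have "\<dots> = gprod G ?F (\<lambda>i. t i x \<otimes> t i y)"
      using tm by (intro gprod_cong) auto
    also have "\<dots> = gprod G ?F (\<lambda>i. t i x) \<otimes> gprod G ?F (\<lambda>i. t i y)"
      by (rule gprod_mult[OF cf[OF xy(1)] cf[OF xy(2)] cm F]) (use comm xy in auto)
    also have "\<dots> = f x \<otimes> f y" using fF[OF xy(1) F] fF[OF xy(2) F] by auto
    finally show ?thesis .
  qed
  moreover have "f (opr K w x) = opr G w (f x)" if wx: "w \<in> Om" "x \<in> carrier K" for w x
  proof -
    let ?F = "{i \<in> I. t i x \<noteq> \<one>}"
    have F: "finite ?F" "?F \<subseteq> I" using fin wx by auto
    have oc: "opr K w x \<in> carrier K" using opr_closed[OF K wx] .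
    have tm: "t i (opr K w x) = opr G w (t i x)" if "i \<in> I" for i
      using omorD(3)[OF t[OF that]] wx by simp
    have cm: "commfam G I (\<lambda>i. opr G w (t i x))"
      using cf[OF oc] tm by (simp add: commfam_def)
    have "f (opr K w x) = gprod G {i \<in> I. t i (opr K w x) \<noteq> \<one>} (\<lambda>i. t i (opr K w x))"
      by (simp add: f_def)
    also have "\<dots> = gprod G ?F (\<lambda>i. t i (opr K w x))"
      using F wx tm by (intro gprod_superset[OF cf[OF oc], symmetric]) (auto simp: opr_one[OF G])
    also have "\<dots> = gprod G ?F (\<lambda>i. opr G w (t i x))"
      using tm by (intro gprod_cong) auto
    also have "\<dots> = opr G w (gprod G ?F (\<lambda>i. t i x))"
      by (rule gprod_hom[OF opr_hom[OF G wx(1)] cf[OF wx(2)] cm F])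
    finally show ?thesis by (simp add: f_def)
  qed
  moreover have "f x \<in> carrier G" if "x \<in> carrier K" for x
    unfolding f_def using gprod_closed[OF cf[OF that]] fin[OF that] by auto
  ultimately have "omor Om K G f" by (auto simp: omor_def hom_def)
  moreover have "f x = t i x" if x: "x \<in> carrier K" "i \<in> I" "\<forall>j\<in>I. j \<noteq> i \<longrightarrow> t j x = \<one>" for x i
  proof -
    have "f x = gprod G {i} (\<lambda>i. t i x)" using x by (intro fF) auto
    also have "\<dots> = t i x" using gprod_insert[OF cf[OF x(1)], of "{}" i] x omorD(1)[OF t] by simp
    finally show ?thesis .
  qed
  moreover have "f x = \<one>" if "x \<in> carrier K" "\<forall>j\<in>I. t j x = \<one>" for x
    using fF[OF that(1), of "{}"] that by auto
  ultimately show ?thesis by blast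
qed

section \<open>Normal morphisms between semisimple groups\<close>

lemma zgen_semisimple: "semisimple Om G \<Longrightarrow> zgen Om G (Zset Om G)"
  by (simp add: zgen_def semisimple_def soc_def)

lemma centralizer_subgroup:
  fixes G :: "('w, 'a) omonoid" (structure)
  assumes "group G" "g \<in> carrier G"
  shows "subgroup {x \<in> carrier G. g \<otimes> x = x \<otimes> g} G"
proof -
  interpret group G by fact
  show ?thesis
  proof (rule subgroup.intro, goal_cases)
    case (2 x y)
    then have c: "x \<in> carrier G" "y \<in> carrier G" "g \<otimes> x = x \<otimes> g" "g \<otimes> y = y \<otimes> g" by auto
    have "g \<otimes> (x \<otimes> y) = x \<otimes> g \<otimes> y" unfolding c(3)[symmetric] using c(1,2) assms(2) by (simp add: m_assoc)
    also have "\<dots> = x \<otimes> (y \<otimes> g)" unfolding c(4)[symmetric] using c(1,2) assms(2) by (simp add: m_assoc)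
    finally show ?case using c(1,2) assms(2) by (simp add: m_assoc)
  next
    case (4 x)
    then have c: "x \<in> carrier G" "g \<otimes> x = x \<otimes> g" by auto
    have "g \<otimes> inv x = inv x \<otimes> (x \<otimes> g) \<otimes> inv x" using c(1) assms(2) by (simp add: m_assoc[symmetric])
    also have "\<dots> = inv x \<otimes> g" unfolding c(2)[symmetric] using c(1) assms(2) by (simp add: m_assoc)
    finally show ?case using c(1) by simp
  qed (use assms(2) in auto)
qed

section \<open>Commutation between isotypic components\<close>

lemma Gcomp_subset_subgroup:
  assumes "ogroup Om G" "subgroup Y G"
    "\<And>F. F \<in> Zset Om G \<Longrightarrow> oiso Om (osub G F) S \<Longrightarrow> F \<subseteq> Y"
  shows "Gcomp Om G S \<subseteq> Y"
  unfolding Gcomp_eq using assms ZsetD(2) by (intro ogen_Union_subset_subgroup) blast+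

lemma Gcomp_osubgroup: "ogroup Om G \<Longrightarrow> osubgroup Om (Gcomp Om G S) G"
  using Gcomp_onormal onormal_osubgroup by blast

lemma Gcomp_carrier: "ogroup Om G \<Longrightarrow> Gcomp Om G S \<subseteq> carrier G"
  using Gcomp_osubgroup osubgroupD(2) by blast

text \<open>\<open>F\<close> differs from every member of type \<open>S\<close> and so commutes with
  the generators of the component; the centraliser of \<open>g\<close> therefore contains all of
  it.\<close>

lemma Zset_Gcomp_commute:
  assumes "ogroup Om G" "F \<in> Zset Om G" "\<not> oiso Om (osub G F) S" "g \<in> F" "n \<in> Gcomp Om G S"
  shows "g \<otimes>\<^bsub>G\<^esub> n = n \<otimes>\<^bsub>G\<^esub> g"
proof -
  have g: "g \<in> carrier G" using ZsetD(4)[OF assms(2)] assms(4) by auto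
  have "Gcomp Om G S \<subseteq> {x \<in> carrier G. g \<otimes>\<^bsub>G\<^esub> x = x \<otimes>\<^bsub>G\<^esub> g}"
  proof (rule Gcomp_subset_subgroup[OF assms(1) centralizer_subgroup[OF ogroup_group[OF assms(1)] g]])
    fix H assume H: "H \<in> Zset Om G" "oiso Om (osub G H) S"
    then have "F \<noteq> H" using assms(3) by auto
    then show "H \<subseteq> {x \<in> carrier G. g \<otimes>\<^bsub>G\<^esub> x = x \<otimes>\<^bsub>G\<^esub> g}"
      using Zset_commute[OF assms(1,2) H(1) _ assms(4)] ZsetD(4)[OF H(1)] by blast
  qed
  then show ?thesis using assms(5) by blast
qed

lemma Gcomp_commute:
  assumes "ogroup Om G" "\<not> oiso Om S S'" "x \<in> Gcomp Om G S" "y \<in> Gcomp Om G S'"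
  shows "x \<otimes>\<^bsub>G\<^esub> y = y \<otimes>\<^bsub>G\<^esub> x"
proof -
  have x: "x \<in> carrier G" using Gcomp_carrier[OF assms(1)] assms(3) by blast
  have "Gcomp Om G S' \<subseteq> {z \<in> carrier G. x \<otimes>\<^bsub>G\<^esub> z = z \<otimes>\<^bsub>G\<^esub> x}"
  proof (rule Gcomp_subset_subgroup[OF assms(1) centralizer_subgroup[OF ogroup_group[OF assms(1)] x]])
    fix F assume F: "F \<in> Zset Om G" "oiso Om (osub G F) S'"
    then have "\<not> oiso Om (osub G F) S" using assms(2) oiso_sym oiso_trans by blast
    then show "F \<subseteq> {z \<in> carrier G. x \<otimes>\<^bsub>G\<^esub> z = z \<otimes>\<^bsub>G\<^esub> x}"
      using Zset_Gcomp_commute[OF assms(1) F(1) _ _ assms(3)] ZsetD(4)[OF F(1)] by force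
  qed
  then show ?thesis using assms(4) by blast
qed

text \<open>It suffices to conjugate by generators of \<open>G\<close>: those of type
  \<open>S\<close> lie in the component and preserve \<open>N\<close>, the others centralise the
  component.\<close>

lemma onormal_Gcomp_lift:
  assumes "zgen Om G \<F>" "onormal Om N (osub G (Gcomp Om G S))"
  shows "onormal Om N G"
proof -
  note G = zgenD[OF assms(1)]
  interpret group G by (rule ogroup_group[OF G(1)])
  have N: "osubgroup Om N G" "N \<subseteq> Gcomp Om G S"
    "\<And>g n. g \<in> Gcomp Om G S \<Longrightarrow> n \<in> N \<Longrightarrow> g \<otimes>\<^bsub>G\<^esub> n \<otimes>\<^bsub>G\<^esub> inv\<^bsub>G\<^esub> g \<in> N"
    using assms(2) by (auto simp: onormal_osub_iff[OF G(1) Gcomp_osubgroup[OF G(1)]])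
  show ?thesis
  proof (rule onormal_by_generators[OF G(1,4,3) N(1)])
    fix F g n assume F: "F \<in> \<F>" "g \<in> F" "n \<in> N"
    have FZ: "F \<in> Zset Om G" using G(2) F by blast
    show "g \<otimes>\<^bsub>G\<^esub> n \<otimes>\<^bsub>G\<^esub> inv\<^bsub>G\<^esub> g \<in> N"
    proof (cases "oiso Om (osub G F) S")
      case True
      then show ?thesis using Zset_subset_Gcomp[OF FZ True] F N(3) by blast
    next
      case False
      have c: "g \<in> carrier G" "n \<in> carrier G" using ZsetD(4)[OF FZ] F osubgroupD(2)[OF N(1)] by auto
      have "g \<otimes>\<^bsub>G\<^esub> n = n \<otimes>\<^bsub>G\<^esub> g" using Zset_Gcomp_commute[OF G(1) FZ False F(2)] N(2) F(3) by blast
      then have "g \<otimes>\<^bsub>G\<^esub> n \<otimes>\<^bsub>G\<^esub> inv\<^bsub>G\<^esub> g = n" using c by (simp add: m_assoc)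
      then show ?thesis using F by simp
    qed
  qed
qed

section \<open>Normal morphisms and their components\<close>

lemma Hom_nD:
  assumes "f \<in> Hom_n Om G G'"
  shows "omor Om G G' f" "f \<in> extensional (carrier G)" "\<And>N. onormal Om N G \<Longrightarrow> onormal Om (f ` N) G'"
  using assms by (auto simp: Hom_n_def)

lemma Hom_n_Zset:
  assumes "ogroup Om G" "ogroup Om G'" "f \<in> Hom_n Om G G'" "H \<in> Zset Om G"
  shows "f ` H = {\<one>\<^bsub>G'\<^esub>} \<or> f ` H \<in> Zset Om G' \<and> oiso Om (osub G H) (osub G' (f ` H))"
  using Zset_image[OF assms(1,2) Hom_nD(1)[OF assms(3)] assms(4) Hom_nD(3)[OF assms(3) ZsetD(1)[OF assms(4)]]]
  by blast

lemma Hom_n_Gcomp: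
  assumes "ogroup Om G" "ogroup Om G'" "f \<in> Hom_n Om G G'"
  shows "f ` Gcomp Om G S \<subseteq> Gcomp Om G' S"
proof -
  note G'S = Gcomp_osubgroup[OF assms(2), of S]
  have "Gcomp Om G S \<subseteq> {x \<in> carrier G. f x \<in> Gcomp Om G' S}"
  proof (rule Gcomp_subset_subgroup[OF assms(1) omor_preimage[OF assms(1,2) Hom_nD(1)[OF assms(3)]]])
    show "subgroup (Gcomp Om G' S) G'" using osubgroupD(1)[OF G'S] .
    fix F assume F: "F \<in> Zset Om G" "oiso Om (osub G F) S"
    have "f ` F \<subseteq> Gcomp Om G' S"
      using Hom_n_Zset[OF assms F(1)]
    proof
      assume "f ` F = {\<one>\<^bsub>G'\<^esub>}"
      then show ?thesis using osubgroupD(3)[OF G'S] by simp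
    next
      assume fF: "f ` F \<in> Zset Om G' \<and> oiso Om (osub G F) (osub G' (f ` F))"
      then have "oiso Om (osub G' (f ` F)) S" using F(2) oiso_sym oiso_trans by blast
      then show ?thesis using fF Zset_subset_Gcomp by blast
    qed
    then show "F \<subseteq> {x \<in> carrier G. f x \<in> Gcomp Om G' S}" using ZsetD(4)[OF F(1)] by blast
  qed
  then show ?thesis by blast
qed

text \<open>A normal subgroup of the component is normal in \<open>G\<close>, so its image is normal
  in \<open>G'\<close> and a fortiori in the component of \<open>G'\<close>.\<close>

lemma Hom_n_restrict_Gcomp:
  assumes "semisimple Om G" "semisimple Om G'" "f \<in> Hom_n Om G G'"
  shows "restrict f (Gcomp Om G S) \<in> Hom_n Om (osub G (Gcomp Om G S)) (osub G' (Gcomp Om G' S))"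
proof -
  note z = zgen_semisimple[OF assms(1)] and z' = zgen_semisimple[OF assms(2)]
  note G = zgenD(1)[OF z] and G' = zgenD(1)[OF z']
  note GS = Gcomp_osubgroup[OF G, of S] and G'S = Gcomp_osubgroup[OF G', of S]
  have im: "f ` Gcomp Om G S \<subseteq> Gcomp Om G' S" by (rule Hom_n_Gcomp[OF G G' assms(3)])
  have "omor Om (osub G (Gcomp Om G S)) (osub G' (Gcomp Om G' S)) (restrict f (Gcomp Om G S))"
    using omor_restrict[OF osub_ogroup[OF G GS] omor_osub[OF Hom_nD(1)[OF assms(3)] Gcomp_carrier[OF G] im]]
    by simp
  moreover have "onormal Om (restrict f (Gcomp Om G S) ` N) (osub G' (Gcomp Om G' S))"
    if N: "onormal Om N (osub G (Gcomp Om G S))" for N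
  proof -
    have sub: "N \<subseteq> Gcomp Om G S" using osubgroupD(2)[OF onormal_osubgroup[OF N]] by simp
    then have eq: "restrict f (Gcomp Om G S) ` N = f ` N" by (auto simp: image_def subset_iff)
    have "onormal Om (f ` N) G'" using Hom_nD(3)[OF assms(3) onormal_Gcomp_lift[OF z N]] .
    then show ?thesis unfolding eq using sub im by (intro onormal_osub[OF G' _ G'S]) auto
  qed
  ultimately show ?thesis by (simp add: Hom_n_def)
qed

text \<open>Passes between components indexed by a class, as in \<Phi>, and components indexed by a
  single group.\<close>

lemma compC_isoclass:
  assumes "ogroup Om S"
  shows "compC Om G (isoclass Om S) = Gcomp Om G S"
proof -
  have "(\<exists>K\<in>isoclass Om S. oiso Om (osub G H) K) \<longleftrightarrow> oiso Om (osub G H) S" for H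
    unfolding isoclass_def using oiso_trans oiso_refl[OF assms] by blast
  then show ?thesis by (simp add: compC_def Gcomp_eq)
qed

text \<open>Reduces normality of the image of a normal subgroup to normality of the images of the
  simple groups generating it.\<close>

lemma image_ogen_Union:
  assumes "ogroup Om G" "ogroup Om G'" "omor Om G G' f" "\<And>F. F \<in> \<F> \<Longrightarrow> osubgroup Om F G"
  shows "f ` ogen Om G (\<Union>\<F>) = ogen Om G' (\<Union>((`) f ` \<F>))"
proof
  have im: "osubgroup Om (f ` F) G'" if "F \<in> \<F>" for F
    using omor_image_osubgroup[OF assms(1-3) assms(4)[OF that]] .
  have R: "osubgroup Om (ogen Om G' (\<Union>((`) f ` \<F>))) G'"
    using osubgroupD(2)[OF im] by (intro ogen_osubgroup[OF assms(2)]) blast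
  have "ogen Om G (\<Union>\<F>) \<subseteq> {x \<in> carrier G. f x \<in> ogen Om G' (\<Union>((`) f ` \<F>))}"
  proof (rule ogen_Union_subset_subgroup[OF assms(1,4) omor_preimage[OF assms(1-3) osubgroupD(1)[OF R]]])
    fix F assume F: "F \<in> \<F>"
    then show "F \<subseteq> {x \<in> carrier G. f x \<in> ogen Om G' (\<Union>((`) f ` \<F>))}"
      using ogen_incl[of "\<Union>((`) f ` \<F>)" Om G'] osubgroupD(2)[OF assms(4)[OF F]] by blast
  qed
  then show "f ` ogen Om G (\<Union>\<F>) \<subseteq> ogen Om G' (\<Union>((`) f ` \<F>))" by blast
  have "osubgroup Om (ogen Om G (\<Union>\<F>)) G"
    using osubgroupD(2)[OF assms(4)] by (intro ogen_osubgroup[OF assms(1)]) blast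
  from omor_image_osubgroup[OF assms(1-3) this]
  show "ogen Om G' (\<Union>((`) f ` \<F>)) \<subseteq> f ` ogen Om G (\<Union>\<F>)"
    using ogen_incl[of "\<Union>\<F>" Om G] by (intro ogen_least) blast+
qed

text \<open>A nontrivial image of \<open>H\<close> would be a copy of \<open>H\<close> inside the
  component, hence isomorphic to one of its generators and so to \<open>S\<close>. Thus a retraction
  onto a component kills the other types, whichever complement produced it.\<close>

lemma nretr_Gcomp_trivial:
  assumes "zgen Om G \<F>" "nretr Om G (Gcomp Om G S) p" "H \<in> Zset Om G" "\<not> oiso Om (osub G H) S" "x \<in> H"
  shows "p x = \<one>\<^bsub>G\<^esub>"
proof (rule ccontr)
  note G = zgenD(1)[OF assms(1)]
  assume "p x \<noteq> \<one>\<^bsub>G\<^esub>"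
  then have nt: "p ` H \<noteq> {\<one>\<^bsub>G\<^esub>}" using assms(5) by blast
  have pm: "omor Om G G p" "onormal Om (p ` H) G"
    using assms(2) ZsetD(1)[OF assms(3)] by (auto simp: nretr_def)
  have K: "p ` H \<in> Zset Om G" "oiso Om (osub G H) (osub G (p ` H))"
    using Zset_image[OF G G pm(1) assms(3) pm(2) nt] by auto
  have "p ` H \<subseteq> Gcomp Om G S" using assms(2) ZsetD(4)[OF assms(3)] by (auto simp: nretr_def)
  then obtain L where "oiso Om (osub G L) S" "oiso Om (osub G L) (osub G (p ` H))"
    using Zset_in_ogen_iso[OF assms(1) _ K(1), of "{H \<in> Zset Om G. oiso Om (osub G H) S}"]
    unfolding Gcomp_eq by blast
  then have "oiso Om (osub G H) S" using K(2) oiso_sym oiso_trans by metis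
  then show False using assms(4) by simp
qed

lemma isoclass_eq_iff:
  assumes "ogroup Om H" shows "isoclass Om H = isoclass Om K \<longleftrightarrow> oiso Om H K"
  using oiso_refl[OF assms] isoclass_eq unfolding isoclass_def by blast

lemma Hom_n_eqI:
  assumes "semisimple Om G" "semisimple Om G'" "f \<in> Hom_n Om G G'" "g \<in> Hom_n Om G G'"
    and eq: "\<And>C x. C \<in> Supp_meet Om G G' \<Longrightarrow> x \<in> compC Om G C \<Longrightarrow> f x = g x"
  shows "f = g"
proof -
  note z = zgen_semisimple[OF assms(1)] and z' = zgen_semisimple[OF assms(2)]
  note G = zgenD(1)[OF z] and G' = zgenD(1)[OF z']
  note f = Hom_nD[OF assms(3)] and g = Hom_nD[OF assms(4)]
  have "carrier G \<subseteq> {x \<in> carrier G. f x = g x}"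
  proof (rule zgen_carrier_subset[OF z omor_equalizer[OF G G' f(1) g(1)]])
    fix F assume F: "F \<in> Zset Om G"
    let ?C = "isoclass Om (osub G F)"
    have "f x = g x" if x: "x \<in> F" for x
    proof (cases "?C \<in> Supp_meet Om G G'")
      case True
      have "x \<in> compC Om G ?C"
        using Zset_subset_Gcomp[OF F oiso_refl[OF ZsetD(6)[OF F]]] x
        by (auto simp: compC_isoclass[OF ZsetD(6)[OF F]])
      then show ?thesis using eq[OF True] by simp
    next
      case False
      \<comment> \<open>A nontrivial image of \<open>F\<close> would be an isomorphic member of
        \<open>Zset Om G'\<close> and would put the class of \<open>F\<close> into
        \<open>Supp_meet\<close>.\<close>
      have triv: "h ` F = {\<one>\<^bsub>G'\<^esub>}" if h: "h \<in> Hom_n Om G G'" for h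
      proof (rule ccontr)
        assume "h ` F \<noteq> {\<one>\<^bsub>G'\<^esub>}"
        then have "h ` F \<in> Zset Om G'" "oiso Om (osub G' (h ` F)) (osub G F)"
          using Hom_n_Zset[OF G G' h F] oiso_sym by auto
        moreover have "osub G F \<in> ?C" using oiso_refl[OF ZsetD(6)[OF F]] by (simp add: isoclass_def)
        moreover have "?C \<in> Supp Om G" using F by (auto simp: Supp_def)
        ultimately have "?C \<in> Supp_meet Om G G'" unfolding Supp_meet_def by blast
        then show False using False by simp
      qed
      then show ?thesis using triv[OF assms(3)] triv[OF assms(4)] x by (metis imageI singletonD)
    qed
    then show "F \<subseteq> {x \<in> carrier G. f x = g x}" using ZsetD(4)[OF F] by blast
  qed
  then show ?thesis using f(2) g(2) by (intro extensionalityI) auto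
qed

text \<open>Multiplying the pieces yields a morphism, but not yet its normality. That is checked on
  members of \<open>Zset Om G\<close>, on each of which at most one factor is nontrivial, and
  extended to all normal subgroups by generation.\<close>

lemma Hom_n_extend:
  fixes G :: "('w, 'a) omonoid" and G' :: "('w, 'b) omonoid"
  assumes ss: "semisimple Om G" "semisimple Om G'"
    and h: "\<And>C. C \<in> Supp_meet Om G G' \<Longrightarrow> h C \<in> Hom_n Om (osub G (compC Om G C)) (osub G' (compC Om G' C))"
  shows "\<exists>f\<in>Hom_n Om G G'. \<forall>C\<in>Supp_meet Om G G'. \<forall>x\<in>compC Om G C. f x = h C x"
proof -
  let ?M = "Supp_meet Om G G'"
  note z = zgen_semisimple[OF ss(1)] and z' = zgen_semisimple[OF ss(2)]
  note G = zgenD(1)[OF z] and G' = zgenD(1)[OF z']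
  interpret G: group G by (rule ogroup_group[OF G])
  interpret G': group G' by (rule ogroup_group[OF G'])
  have "\<forall>C\<in>?M. \<exists>H. H \<in> Zset Om G \<and> C = isoclass Om (osub G H)"
    by (auto simp: Supp_meet_def Supp_def)
  \<comment> \<open>One simple normal subgroup of \<open>G\<close> is chosen per class. It names the
    component on both sides, although the two groups may have different carrier types.\<close>
  from bchoice[OF this] obtain R
    where R: "\<And>C. C \<in> ?M \<Longrightarrow> R C \<in> Zset Om G" "\<And>C. C \<in> ?M \<Longrightarrow> C = isoclass Om (osub G (R C))"
    by blast
  define A where "A C = Gcomp Om G (osub G (R C))" for C
  define A' where "A' C = Gcomp Om G' (osub G (R C))" for C
  have compA: "compC Om G C = A C" "compC Om G' C = A' C" if "C \<in> ?M" for C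
    using R[OF that] compC_isoclass[OF ZsetD(6)[OF R(1)[OF that]], of G]
      compC_isoclass[OF ZsetD(6)[OF R(1)[OF that]], of G'] by (auto simp: A_def A'_def)
  have An: "onormal Om (A C) G" "osubgroup Om (A C) G" "A C \<subseteq> carrier G" for C
    unfolding A_def using Gcomp_onormal[OF G] Gcomp_osubgroup[OF G] Gcomp_carrier[OF G] by auto
  have A'n: "osubgroup Om (A' C) G'" "A' C \<subseteq> carrier G'" for C
    unfolding A'_def using Gcomp_osubgroup[OF G'] Gcomp_carrier[OF G'] by auto
  have h': "h C \<in> Hom_n Om (osub G (A C)) (osub G' (A' C))" if "C \<in> ?M" for C
    using h[OF that] compA[OF that] by simp
  have "\<exists>p. nretr Om G (A C) p" for C using zgen_nretr[OF z An(1)] .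
  then obtain p where p: "\<And>C. nretr Om G (A C) (p C)" by metis
  have pm: "omor Om G G (p C)" "p C ` carrier G = A C" "\<And>n. n \<in> A C \<Longrightarrow> p C n = n" for C
    using p[of C] by (auto simp: nretr_def)
  define t where "t C x = h C (p C x)" for C x
  have to: "omor Om G (osub G' (A' C)) (t C)" if "C \<in> ?M" for C
    unfolding t_def
    using omor_comp[OF omor_into_osub[OF pm(1)] Hom_nD(1)[OF h'[OF that]]] pm(2)[of C] by simp
  have tm: "omor Om G G' (t C)" if "C \<in> ?M" for C using omor_from_osub[OF to[OF that] A'n(2)] .
  have h1: "h C \<one>\<^bsub>G\<^esub> = \<one>\<^bsub>G'\<^esub>" if "C \<in> ?M" for C
    using omor_one[OF osub_ogroup[OF G An(2)] osub_ogroup[OF G' A'n(1)] Hom_nD(1)[OF h'[OF that]]] by simp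
  have diff: "\<not> oiso Om (osub G (R C)) (osub G (R D))" if "C \<in> ?M" "D \<in> ?M" "C \<noteq> D" for C D
    using isoclass_eq R(2) that by metis
  \<comment> \<open>This one fact yields the finiteness of supports, the values of \<open>f\<close>
    on the components and its triviality on the remaining types.\<close>
  have pF: "C = isoclass Om (osub G F)" if "C \<in> ?M" "F \<in> Zset Om G" "x \<in> F" "p C x \<noteq> \<one>\<^bsub>G\<^esub>" for C F x
  proof -
    have "oiso Om (osub G F) (osub G (R C))"
      using nretr_Gcomp_trivial[OF z p[of C, unfolded A_def] that(2) _ that(3)] that(4) by blast
    then show ?thesis using isoclass_eq R(2)[OF that(1)] by metis
  qed
  have fin: "finite {C \<in> ?M. p C x \<noteq> \<one>\<^bsub>G\<^esub>}" if "x \<in> carrier G" for x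
  proof -
    \<comment> \<open>Finite support is closed under the group operations, and on a generator the
      support contains at most the class of that generator.\<close>
    let ?Y = "{x \<in> carrier G. finite {C \<in> ?M. p C x \<noteq> \<one>\<^bsub>G\<^esub>}}"
    have "subgroup ?Y G"
    proof (rule subgroup.intro, goal_cases)
      case (2 x y)
      have "{C \<in> ?M. p C (x \<otimes>\<^bsub>G\<^esub> y) \<noteq> \<one>\<^bsub>G\<^esub>} \<subseteq> {C \<in> ?M. p C x \<noteq> \<one>\<^bsub>G\<^esub>} \<union> {C \<in> ?M. p C y \<noteq> \<one>\<^bsub>G\<^esub>}"
        using 2 omorD(2)[OF pm(1)] by auto
      moreover have "finite ({C \<in> ?M. p C x \<noteq> \<one>\<^bsub>G\<^esub>} \<union> {C \<in> ?M. p C y \<noteq> \<one>\<^bsub>G\<^esub>})" using 2 by simp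
      ultimately have "finite {C \<in> ?M. p C (x \<otimes>\<^bsub>G\<^esub> y) \<noteq> \<one>\<^bsub>G\<^esub>}" by (rule finite_subset)
      then show ?case using 2 by simp
    next
      case 3 then show ?case using omor_one[OF G G pm(1)] by simp
    next
      case (4 x)
      then show ?case using omor_inv[OF G G pm(1)] omorD(1)[OF pm(1)] by simp
    qed auto
    moreover have "F \<subseteq> ?Y" if F: "F \<in> Zset Om G" for F
    proof
      fix x assume x: "x \<in> F"
      have "{C \<in> ?M. p C x \<noteq> \<one>\<^bsub>G\<^esub>} \<subseteq> {isoclass Om (osub G F)}" using pF[OF _ F x] by blast
      then have "finite {C \<in> ?M. p C x \<noteq> \<one>\<^bsub>G\<^esub>}" by (rule finite_subset) simp
      then show "x \<in> ?Y" using x ZsetD(4)[OF F] by blast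
    qed
    ultimately show ?thesis using zgen_carrier_subset[OF z] that by blast
  qed
  have "\<exists>f. omor Om G G' f \<and>
    (\<forall>x\<in>carrier G. \<forall>C\<in>?M. (\<forall>D\<in>?M. D \<noteq> C \<longrightarrow> t D x = \<one>\<^bsub>G'\<^esub>) \<longrightarrow> f x = t C x) \<and>
    (\<forall>x\<in>carrier G. (\<forall>D\<in>?M. t D x = \<one>\<^bsub>G'\<^esub>) \<longrightarrow> f x = \<one>\<^bsub>G'\<^esub>)"
  proof (rule omor_product_exists[OF G G' tm])
    fix C D x y assume CD: "C \<in> ?M" "D \<in> ?M" "C \<noteq> D" "x \<in> carrier G" "y \<in> carrier G"
    have "t C x \<in> A' C" "t D y \<in> A' D" using omorD(1)[OF to] CD by auto
    then show "t C x \<otimes>\<^bsub>G'\<^esub> t D y = t D y \<otimes>\<^bsub>G'\<^esub> t C x"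
      unfolding A'_def using Gcomp_commute[OF G' diff[OF CD(1-3)]] by blast
  next
    fix x assume x: "x \<in> carrier G"
    have "{C \<in> ?M. t C x \<noteq> \<one>\<^bsub>G'\<^esub>} \<subseteq> {C \<in> ?M. p C x \<noteq> \<one>\<^bsub>G\<^esub>}" using h1 by (auto simp: t_def)
    then show "finite {C \<in> ?M. t C x \<noteq> \<one>\<^bsub>G'\<^esub>}" using fin[OF x] finite_subset by blast
  qed
  then obtain f where f: "omor Om G G' f"
    and f1: "\<forall>x\<in>carrier G. \<forall>C\<in>?M. (\<forall>D\<in>?M. D \<noteq> C \<longrightarrow> t D x = \<one>\<^bsub>G'\<^esub>) \<longrightarrow> f x = t C x"
    and f2: "\<forall>x\<in>carrier G. (\<forall>D\<in>?M. t D x = \<one>\<^bsub>G'\<^esub>) \<longrightarrow> f x = \<one>\<^bsub>G'\<^esub>"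
    by (elim exE conjE)
  have fA: "f x = h C x" if C: "C \<in> ?M" and x: "x \<in> A C" for C x
  proof -
    \<comment> \<open>Every generator of \<open>A C\<close> has class \<open>C\<close>, so
      \<open>p D\<close> kills it, and with it all of \<open>A C\<close>.\<close>
    have "t D x = \<one>\<^bsub>G'\<^esub>" if D: "D \<in> ?M" "D \<noteq> C" for D
    proof -
      have "A C \<subseteq> {x \<in> carrier G. p D x \<in> {\<one>\<^bsub>G\<^esub>}}" unfolding A_def
      proof (rule Gcomp_subset_subgroup[OF G omor_preimage[OF G G pm(1) G.triv_subgroup]])
        fix F assume F: "F \<in> Zset Om G" "oiso Om (osub G F) (osub G (R C))"
        then have "D \<noteq> isoclass Om (osub G F)" using isoclass_eq[OF F(2)] R(2)[OF C] D(2) by metis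
        then show "F \<subseteq> {x \<in> carrier G. p D x \<in> {\<one>\<^bsub>G\<^esub>}}"
          using pF[OF D(1) F(1)] ZsetD(4)[OF F(1)] by blast
      qed
      then show ?thesis using x h1[OF D(1)] by (auto simp: t_def)
    qed
    moreover have "x \<in> carrier G" using An(3) x by blast
    ultimately have "f x = t C x" using f1 C by simp
    then show ?thesis using pm(3)[OF x] by (simp add: t_def)
  qed
  \<comment> \<open>If the class of \<open>K\<close> is in \<open>Supp_meet\<close>, then
    \<open>f\<close> agrees on \<open>K\<close> with the normal morphism \<open>h C\<close>, and
    normality in the component lifts to \<open>G'\<close>. Otherwise all factors vanish on
    \<open>K\<close>.\<close>
  have fK: "onormal Om (f ` K) G'" if K: "K \<in> Zset Om G" for K
  proof (cases "isoclass Om (osub G K) \<in> ?M")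
    case True
    define C where "C = isoclass Om (osub G K)"
    have CM: "C \<in> ?M" using True C_def by simp
    have "oiso Om (osub G K) (osub G (R C))"
      using isoclass_eq_iff[OF ZsetD(6)[OF K]] R(2)[OF CM] C_def by metis
    then have KA: "K \<subseteq> A C" unfolding A_def by (rule Zset_subset_Gcomp[OF K])
    have "onormal Om (h C ` K) (osub G' (A' C))"
      using Hom_nD(3)[OF h'[OF CM] onormal_osub[OF G ZsetD(1)[OF K] An(2) KA]] .
    then have "onormal Om (h C ` K) G'" unfolding A'_def by (rule onormal_Gcomp_lift[OF z'])
    moreover have "f ` K = h C ` K" using fA[OF CM] KA by (intro image_cong) auto
    ultimately show ?thesis by simp
  next
    case False
    have "f x = \<one>\<^bsub>G'\<^esub>" if x: "x \<in> K" for x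
    proof -
      have "x \<in> carrier G" using x ZsetD(4)[OF K] by auto
      moreover have "t D x = \<one>\<^bsub>G'\<^esub>" if "D \<in> ?M" for D
        using pF[OF that K x] that False h1[OF that] by (metis t_def)
      ultimately show ?thesis using f2 by simp
    qed
    then have "f ` K = {\<one>\<^bsub>G'\<^esub>}" using osubgroupD(3)[OF ZsetD(2)[OF K]] by (auto simp: image_def)
    then show ?thesis using onormal_one[OF G'] by simp
  qed
  define f0 where "f0 = restrict f (carrier G)"
  have "onormal Om (f0 ` N) G'" if N: "onormal Om N G" for N
  proof -
    let ?K = "{K \<in> Zset Om G. K \<subseteq> N}"
    have "f ` N = f ` ogen Om G (\<Union>?K)" using zgen_onormal_ogen[OF z N] by simp
    also have "\<dots> = ogen Om G' (\<Union>((`) f ` ?K))"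
      using ZsetD(2) by (intro image_ogen_Union[OF G G' f]) blast
    also have "onormal Om \<dots> G'" using fK by (intro ogen_Union_onormal[OF G']) blast
    finally have "onormal Om (f ` N) G'" .
    moreover have "f0 ` N = f ` N"
      using osubgroupD(2)[OF onormal_osubgroup[OF N]] unfolding f0_def by (intro image_cong) auto
    ultimately show ?thesis by simp
  qed
  then have "f0 \<in> Hom_n Om G G'"
    using omor_restrict[OF G f] by (simp add: Hom_n_def f0_def)
  moreover have "f0 x = h C x" if "C \<in> ?M" "x \<in> compC Om G C" for C x
    using that fA[OF that(1)] compA[OF that(1)] An(3)[of C] by (auto simp: f0_def)
  ultimately show ?thesis by blast
qed

lemma Hom_n_components_bij:
  assumes ss: "semisimple Om G" "semisimple Om G'"
  shows "bij_betw (\<lambda>f. \<lambda>C\<in>Supp_meet Om G G'. restrict f (compC Om G C))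
    (Hom_n Om G G')
    (\<Pi>\<^sub>E C\<in>Supp_meet Om G G'. Hom_n Om (osub G (compC Om G C)) (osub G' (compC Om G' C)))"
    (is "bij_betw ?\<Phi> _ (PiE ?M ?B)")
proof (rule bij_betw_imageI)
  show "inj_on ?\<Phi> (Hom_n Om G G')"
  proof (rule inj_onI)
    fix f g assume fg: "f \<in> Hom_n Om G G'" "g \<in> Hom_n Om G G'" "?\<Phi> f = ?\<Phi> g"
    show "f = g"
    proof (rule Hom_n_eqI[OF ss fg(1,2)])
      fix C x assume "C \<in> ?M" "x \<in> compC Om G C"
      then show "f x = g x" using fun_cong[OF fun_cong[OF fg(3), of C], of x] by simp
    qed
  qed
  have "?\<Phi> f \<in> PiE ?M ?B" if f: "f \<in> Hom_n Om G G'" for f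
  proof
    fix C assume C: "C \<in> ?M"
    then have "C \<in> Supp Om G" by (simp add: Supp_meet_def)
    then obtain H where H: "H \<in> Zset Om G" "C = isoclass Om (osub G H)" by (auto simp: Supp_def)
    show "?\<Phi> f C \<in> ?B C"
      using Hom_n_restrict_Gcomp[OF ss f, of "osub G H"] C
      by (simp add: H(2) compC_isoclass[OF ZsetD(6)[OF H(1)]])
  qed simp
  moreover have "h \<in> ?\<Phi> ` Hom_n Om G G'" if h: "h \<in> PiE ?M ?B" for h
  proof -
    have hC: "h C \<in> ?B C" if "C \<in> ?M" for C using h that by auto
    obtain f where f: "f \<in> Hom_n Om G G'" "\<And>C x. C \<in> ?M \<Longrightarrow> x \<in> compC Om G C \<Longrightarrow> f x = h C x"
      using Hom_n_extend[OF ss hC] by blast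
    have "restrict f (compC Om G C) = h C" if C: "C \<in> ?M" for C
    proof (rule extensionalityI)
      show "h C \<in> extensional (compC Om G C)" using Hom_nD(2)[OF hC[OF C]] by simp
    qed (use f(2)[OF C] in auto)
    then have "?\<Phi> f C = h C" for C using h by (cases "C \<in> ?M") (auto simp: PiE_def extensional_def)
    then have "?\<Phi> f = h" by (rule ext)
    then show ?thesis using f(1) by blast
  qed
  ultimately show "?\<Phi> ` Hom_n Om G G' = PiE ?M ?B" by blast
qed

section \<open>Internal direct sums\<close>

lemma odsum_simps [simp]:
  "carrier (odsum Om I Gs) = {x \<in> \<Pi>\<^sub>E i\<in>I. carrier (Gs i). finite {i \<in> I. x i \<noteq> \<one>\<^bsub>Gs i\<^esub>}}"
  "x \<otimes>\<^bsub>odsum Om I Gs\<^esub> y = (\<lambda>i\<in>I. x i \<otimes>\<^bsub>Gs i\<^esub> y i)"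
  "\<one>\<^bsub>odsum Om I Gs\<^esub> = (\<lambda>i\<in>I. \<one>\<^bsub>Gs i\<^esub>)"
  "opr (odsum Om I Gs) w x = (\<lambda>i\<in>I. opr (Gs i) w (x i))"
  by (simp_all add: odsum_def omonoid.make_def)

abbreviation (input) odsub :: "'w set \<Rightarrow> 'i set \<Rightarrow> ('w, 'a) omonoid \<Rightarrow> ('i \<Rightarrow> 'a set) \<Rightarrow> ('w, 'i \<Rightarrow> 'a) omonoid" where
  "odsub Om I G H \<equiv> odsum Om I (\<lambda>i. osub G (H i))"

lemma odsum_ogroup:
  fixes G :: "('w, 'a) omonoid" (structure)
  assumes G: "ogroup Om G" and H: "\<And>i. i \<in> I \<Longrightarrow> osubgroup Om (H i) G"
  shows "ogroup Om (odsub Om I G H)"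
proof -
  interpret group G by (rule ogroup_group[OF G])
  have fin2: "finite {i \<in> I. x i \<otimes> y i \<noteq> \<one>}"
    if "finite {i \<in> I. x i \<noteq> \<one>}" "finite {i \<in> I. y i \<noteq> \<one>}" for x y :: "'b \<Rightarrow> 'a"
  proof (rule finite_subset)
    show "{i \<in> I. x i \<otimes> y i \<noteq> \<one>} \<subseteq> {i \<in> I. x i \<noteq> \<one>} \<union> {i \<in> I. y i \<noteq> \<one>}" by auto
  qed (use that in simp)
  have fin1: "finite {i \<in> I. h (x i) \<noteq> \<one>}"
    if "finite {i \<in> I. x i \<noteq> \<one>}" "h \<one> = \<one>" for x :: "'b \<Rightarrow> 'a" and h
    by (rule finite_subset[OF _ that(1)]) (use that(2) in auto)
  have mem: "restrict u I \<in> carrier (odsub Om I G H)"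
    if "\<And>i. i \<in> I \<Longrightarrow> u i \<in> H i" "finite {i \<in> I. u i \<noteq> \<one>}" for u
  proof -
    have "{i \<in> I. restrict u I i \<noteq> \<one>} = {i \<in> I. u i \<noteq> \<one>}" by auto
    then show ?thesis using that by simp
  qed
  have carD: "x \<in> PiE I H" "finite {i \<in> I. x i \<noteq> \<one>}" if "x \<in> carrier (odsub Om I G H)" for x
    using that by auto
  have Hm: "x i \<in> H i" if "x \<in> carrier (odsub Om I G H)" "i \<in> I" for x i
    using carD(1)[OF that(1)] that(2) by blast
  have Hc: "x i \<in> carrier G" if "x \<in> carrier (odsub Om I G H)" "i \<in> I" for x i
    using Hm[OF that] osubgroupD(2)[OF H[OF that(2)]] by blast
  have "group (odsub Om I G H)"
  proof (rule groupI, goal_cases)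
    case (1 x y)
    have "(\<lambda>i\<in>I. x i \<otimes> y i) \<in> carrier (odsub Om I G H)"
    proof (rule mem)
      show "x i \<otimes> y i \<in> H i" if "i \<in> I" for i
        using osubgroupD(4)[OF H[OF that] Hm[OF 1(1) that] Hm[OF 1(2) that]] .
    qed (rule fin2[OF carD(2)[OF 1(1)] carD(2)[OF 1(2)]])
    then show ?case by simp
  next
    case 2
    have "(\<lambda>i\<in>I. \<one>) \<in> carrier (odsub Om I G H)"
      by (rule mem) (simp_all add: osubgroupD(3)[OF H])
    then show ?case by simp
  next
    case (3 x y z)
    then show ?case unfolding odsum_simps(2) osub_simps using Hc m_assoc by (intro restrict_ext) simp
  next
    case (4 x)
    have "(\<lambda>i\<in>I. \<one> \<otimes> x i) = x"
    proof
      fix i show "(\<lambda>i\<in>I. \<one> \<otimes> x i) i = x i"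
        using Hc[OF 4] PiE_arb[OF carD(1)[OF 4]] by (cases "i \<in> I") simp_all
    qed
    then show ?case by (simp cong: restrict_cong)
  next
    case (5 x)
    let ?y = "\<lambda>i\<in>I. inv (x i)"
    have "?y \<in> carrier (odsub Om I G H)"
    proof (rule mem)
      show "inv (x i) \<in> H i" if "i \<in> I" for i
        using osubgroupD(5)[OF H[OF that] Hm[OF 5 that]] .
    qed (rule fin1[OF carD(2)[OF 5]], simp)
    moreover have "?y \<otimes>\<^bsub>odsub Om I G H\<^esub> x = \<one>\<^bsub>odsub Om I G H\<^esub>"
      unfolding odsum_simps(2,3) osub_simps using Hc[OF 5] by (intro restrict_ext) simp
    ultimately show ?case by blast
  qed
  moreover have "opr (odsub Om I G H) w \<in> hom (odsub Om I G H) (odsub Om I G H)" if w: "w \<in> Om" for w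
  proof (rule homI, goal_cases)
    case (1 x)
    have "(\<lambda>i\<in>I. opr G w (x i)) \<in> carrier (odsub Om I G H)"
    proof (rule mem)
      show "opr G w (x i) \<in> H i" if "i \<in> I" for i
        using osubgroupD(6)[OF H[OF that] w Hm[OF 1 that]] .
    qed (rule fin1[where h = "opr G w", OF carD(2)[OF 1] opr_one[OF G w]])
    then show ?case by simp
  next
    case (2 x y)
    then show ?case unfolding odsum_simps(2,4) osub_simps using Hc opr_mult[OF G w] by (intro restrict_ext) simp
  qed
  ultimately show ?thesis by (simp add: ogroup_def)
qed

section \<open>The canonical morphism from a restricted direct sum\<close>

lemma odsum_eval_omor:
  assumes "i \<in> I"
  shows "omor Om (odsub Om I G H) (osub G (H i)) (\<lambda>x. x i)"
  using assms by (auto simp: omor_def hom_def PiE_iff)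

lemma oinj_closed:
  assumes "ogroup Om G" "\<And>i. i \<in> I \<Longrightarrow> osubgroup Om (H i) G" "i \<in> I" "x \<in> H i"
  shows "oinj G I i x \<in> carrier (odsub Om I G H)"
proof -
  have "finite {j \<in> I. oinj G I i x j \<noteq> \<one>\<^bsub>G\<^esub>}"
    by (rule finite_subset[of _ "{i}"]) (auto simp: oinj_def)
  moreover have "oinj G I i x \<in> PiE I H"
    unfolding oinj_def restrict_PiE_iff using osubgroupD(3)[OF assms(2)] assms(4) by simp
  ultimately show ?thesis by simp
qed

text \<open>Induction on a finite set covering the support: one coordinate at a time is split off as
  an injected element, on which the two morphisms agree.\<close>

lemma odsum_omor_eqI:
  fixes G :: "('w, 'a) omonoid" (structure)
  assumes G: "ogroup Om G" and H: "\<And>i. i \<in> I \<Longrightarrow> osubgroup Om (H i) G" and G': "ogroup Om G'"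
    and s: "omor Om (odsub Om I G H) G' s" and t: "omor Om (odsub Om I G H) G' t"
    and eq: "\<And>i x. i \<in> I \<Longrightarrow> x \<in> H i \<Longrightarrow> s (oinj G I i x) = t (oinj G I i x)"
    and x: "x \<in> carrier (odsub Om I G H)"
  shows "s x = t x"
proof -
  let ?D = "odsub Om I G H"
  interpret group G by (rule ogroup_group[OF G])
  note D = odsum_ogroup[OF G H]
  have main: "\<forall>x\<in>carrier ?D. {i \<in> I. x i \<noteq> \<one>} \<subseteq> F \<longrightarrow> s x = t x" if "finite F" for F
    using that
  proof (induction F)
    case empty
    show ?case
    proof (intro ballI impI)
      fix x assume x: "x \<in> carrier ?D" "{i \<in> I. x i \<noteq> \<one>} \<subseteq> {}"
      have "x i = \<one>\<^bsub>?D\<^esub> i" for i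
        using x(2) PiE_arb[of x I H i] x(1) by (cases "i \<in> I") auto
      then have "x = \<one>\<^bsub>?D\<^esub>" by (rule ext)
      then show "s x = t x" using omor_one[OF D G' s] omor_one[OF D G' t] by (simp del: odsum_simps)
    qed
  next
    case (insert i F)
    show ?case
    proof (intro ballI impI)
      fix x assume x: "x \<in> carrier ?D" "{j \<in> I. x j \<noteq> \<one>} \<subseteq> insert i F"
      show "s x = t x"
      proof (cases "i \<in> I")
        case False
        then have "{j \<in> I. x j \<noteq> \<one>} \<subseteq> F" using x(2) by blast
        then show ?thesis using insert.IH x(1) by blast
      next
        case True
        let ?y = "x(i := \<one>)"
        have xP: "x \<in> PiE I H" "finite {j \<in> I. x j \<noteq> \<one>}" using x(1) by auto
        have y: "?y \<in> carrier ?D"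
        proof -
          have "finite {j \<in> I. ?y j \<noteq> \<one>}" by (rule finite_subset[OF _ xP(2)]) auto
          moreover have "?y \<in> PiE I H" using xP(1) True osubgroupD(3)[OF H[OF True]] by (auto simp: PiE_iff extensional_def)
          ultimately show ?thesis by simp
        qed
        have xi: "x i \<in> H i" using xP(1) True by blast
        have xc: "x j \<in> carrier G" if "j \<in> I" for j using xP(1) osubgroupD(2)[OF H[OF that]] that by blast
        note o = oinj_closed[where H = H, OF G H True xi]
        have "x j = (oinj G I i (x i) \<otimes>\<^bsub>?D\<^esub> ?y) j" for j
          using PiE_arb[OF xP(1), of j] xc[of j] by (cases "j \<in> I") (auto simp: oinj_def)
        then have "x = oinj G I i (x i) \<otimes>\<^bsub>?D\<^esub> ?y" by (rule ext)
        then have "s x = s (oinj G I i (x i)) \<otimes>\<^bsub>G'\<^esub> s ?y" "t x = t (oinj G I i (x i)) \<otimes>\<^bsub>G'\<^esub> t ?y"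
          using omorD(2)[OF s o y] omorD(2)[OF t o y] by simp_all
        moreover have "{j \<in> I. ?y j \<noteq> \<one>} \<subseteq> F" using x(2) by auto
        then have "s ?y = t ?y" using insert.IH y by blast
        ultimately show ?thesis using eq[OF True xi] by simp
      qed
    qed
  qed
  show ?thesis using main[of "{i \<in> I. x i \<noteq> \<one>}"] x by simp
qed

text \<open>Justifies the description operator in \<open>theta\<close>. Existence multiplies the
  commuting coordinate maps; uniqueness holds because the injected summands generate the direct sum
  and extensionality fixes the values off its carrier.\<close>

lemma theta_unique_exists:
  fixes G :: "('w, 'a) omonoid" (structure)
  assumes G: "ogroup Om G" and H: "\<And>i. i \<in> I \<Longrightarrow> osubgroup Om (H i) G" and CC: "CC G I H"
  shows "\<exists>!t. omor Om (odsub Om I G H) G t \<and> t \<in> extensional (carrier (odsub Om I G H)) \<and>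
    (\<forall>i\<in>I. \<forall>x\<in>H i. t (oinj G I i x) = x)"
proof (rule ex_ex1I)
  let ?D = "odsub Om I G H"
  note D = odsum_ogroup[OF G H]
  have "\<exists>f. omor Om ?D G f \<and>
    (\<forall>x\<in>carrier ?D. \<forall>i\<in>I. (\<forall>j\<in>I. j \<noteq> i \<longrightarrow> x j = \<one>) \<longrightarrow> f x = x i) \<and>
    (\<forall>x\<in>carrier ?D. (\<forall>j\<in>I. x j = \<one>) \<longrightarrow> f x = \<one>)"
  proof (rule omor_product_exists[OF D G])
    show "omor Om ?D G (\<lambda>x. x i)" if "i \<in> I" for i
      by (rule omor_from_osub[OF odsum_eval_omor[where H = H, OF that] osubgroupD(2)[OF H[OF that]]])
    show "x i \<otimes> y j = y j \<otimes> x i" if "i \<in> I" "j \<in> I" "i \<noteq> j" "x \<in> carrier ?D" "y \<in> carrier ?D" for i j x y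
      using that CC by (auto simp: CC_def PiE_iff)
    show "finite {i \<in> I. x i \<noteq> \<one>}" if "x \<in> carrier ?D" for x
      using that by simp
  qed
  then obtain f where f: "omor Om ?D G f"
    "\<forall>x\<in>carrier ?D. \<forall>i\<in>I. (\<forall>j\<in>I. j \<noteq> i \<longrightarrow> x j = \<one>) \<longrightarrow> f x = x i" by (elim exE conjE)
  have "f (oinj G I i x) = x" if "i \<in> I" "x \<in> H i" for i x
  proof -
    have "f (oinj G I i x) = oinj G I i x i"
      using f(2)[rule_format, OF oinj_closed[where H = H, OF G H that] that(1)] by (auto simp: oinj_def)
    then show ?thesis using that by (simp add: oinj_def)
  qed
  then have "\<forall>i\<in>I. \<forall>x\<in>H i. restrict f (carrier ?D) (oinj G I i x) = x"
    using oinj_closed[where H = H, OF G H] by (simp del: odsum_simps)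
  then show "\<exists>t. omor Om ?D G t \<and> t \<in> extensional (carrier ?D) \<and> (\<forall>i\<in>I. \<forall>x\<in>H i. t (oinj G I i x) = x)"
    using omor_restrict[OF D f(1)] restrict_extensional by blast
next
  fix s t
  let ?D = "odsub Om I G H"
  assume st: "omor Om ?D G s \<and> s \<in> extensional (carrier ?D) \<and> (\<forall>i\<in>I. \<forall>x\<in>H i. s (oinj G I i x) = x)"
    "omor Om ?D G t \<and> t \<in> extensional (carrier ?D) \<and> (\<forall>i\<in>I. \<forall>x\<in>H i. t (oinj G I i x) = x)"
  then have s: "omor Om ?D G s" "s \<in> extensional (carrier ?D)" "\<And>i x. i \<in> I \<Longrightarrow> x \<in> H i \<Longrightarrow> s (oinj G I i x) = x"
    and t: "omor Om ?D G t" "t \<in> extensional (carrier ?D)" "\<And>i x. i \<in> I \<Longrightarrow> x \<in> H i \<Longrightarrow> t (oinj G I i x) = x"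
    by simp_all
  show "s = t"
  proof (rule extensionalityI[OF s(2) t(2)])
    show "s x = t x" if "x \<in> carrier ?D" for x
      by (rule odsum_omor_eqI[where H = H, OF G H G s(1) t(1) _ that]) (simp_all add: s(3) t(3))
  qed
qed

lemma theta_omor:
  assumes "ogroup Om G" "\<And>i. i \<in> I \<Longrightarrow> osubgroup Om (H i) G" "CC G I H"
  shows "omor Om (odsub Om I G H) G (theta Om I H G)"
    "\<And>i x. i \<in> I \<Longrightarrow> x \<in> H i \<Longrightarrow> theta Om I H G (oinj G I i x) = x"
  using theI'[OF theta_unique_exists[OF assms]] unfolding theta_def by auto

section \<open>Coordinates of an internal direct sum\<close>

locale internal_sum =
  fixes Om :: "'w set" and G :: "('w, 'a) omonoid" and I :: "'i set" and H :: "'i \<Rightarrow> 'a set"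
  assumes ogroup: "ogroup Om G" and sub: "i \<in> I \<Longrightarrow> osubgroup Om (H i) G" and CC: "CC G I H"
    and bij: "bij_betw (theta Om I H G) (carrier (odsub Om I G H)) (carrier G)"
begin

definition coords :: "'a \<Rightarrow> 'i \<Rightarrow> 'a" where
  "coords = inv_into (carrier (odsub Om I G H)) (theta Om I H G)"

lemma coords_omor: "omor Om G (odsub Om I G H) coords"
  unfolding coords_def
  using omor_inv_into[OF odsum_ogroup[OF ogroup sub] ogroup theta_omor(1)[OF ogroup sub CC] bij] .

lemma theta_coords: "y \<in> carrier G \<Longrightarrow> theta Om I H G (coords y) = y"
  unfolding coords_def using bij by (metis bij_betw_def f_inv_into_f)

lemma coords_theta: "x \<in> carrier (odsub Om I G H) \<Longrightarrow> coords (theta Om I H G x) = x"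
  unfolding coords_def using bij by (simp add: bij_betw_def del: odsum_simps)

lemma proj_omor: "i \<in> I \<Longrightarrow> omor Om G (osub G (H i)) (\<lambda>y. coords y i)"
  using omor_comp[OF coords_omor odsum_eval_omor] by blast

lemma proj_id: "i \<in> I \<Longrightarrow> x \<in> H i \<Longrightarrow> coords x i = x"
  using coords_theta[OF oinj_closed[where H = H, OF ogroup sub]] theta_omor(2)[OF ogroup sub CC]
  by (simp add: oinj_def)

lemma proj_onto: "i \<in> I \<Longrightarrow> (\<lambda>y. coords y i) ` carrier G = carrier (osub G (H i))"
  using omorD(1)[OF proj_omor] proj_id osubgroupD(2)[OF sub] by (force simp: image_iff)

lemma coords_nontrivial:
  assumes "y \<in> carrier G" "y \<noteq> \<one>\<^bsub>G\<^esub>"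
  shows "\<exists>i\<in>I. coords y i \<noteq> \<one>\<^bsub>G\<^esub>"
proof (rule ccontr)
  assume neg: "\<not> (\<exists>i\<in>I. coords y i \<noteq> \<one>\<^bsub>G\<^esub>)"
  have "coords y \<in> carrier (odsub Om I G H)" using omorD(1)[OF coords_omor assms(1)] .
  then have "coords y i = \<one>\<^bsub>odsub Om I G H\<^esub> i" for i
    using neg PiE_arb[of "coords y" I H i] by (cases "i \<in> I") auto
  then have "coords y = \<one>\<^bsub>odsub Om I G H\<^esub>" by (rule ext)
  then have "y = \<one>\<^bsub>G\<^esub>"
    using theta_coords[OF assms(1)]
      omor_one[OF odsum_ogroup[OF ogroup sub] ogroup theta_omor(1)[OF ogroup sub CC]] by metis
  then show False using assms(2) by simp
qed

text \<open>In the direct sum, moving the coordinates of \<open>g\<close> past an element injected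
  at \<open>i\<close> changes only coordinate \<open>i\<close>, where it is conjugation;
  \<open>theta\<close> carries this identity to \<open>G\<close>.\<close>

lemma conj_eq_coord_conj:
  assumes i: "i \<in> I" and g: "g \<in> carrier G" and k: "k \<in> H i"
  shows "g \<otimes>\<^bsub>G\<^esub> k \<otimes>\<^bsub>G\<^esub> inv\<^bsub>G\<^esub> g = coords g i \<otimes>\<^bsub>G\<^esub> k \<otimes>\<^bsub>G\<^esub> inv\<^bsub>G\<^esub> (coords g i)"
proof -
  interpret group G by (rule ogroup_group[OF ogroup])
  let ?D = "odsub Om I G H" and ?\<theta> = "theta Om I H G"
  let ?x = "coords g"
  have x: "?x \<in> carrier ?D" using omorD(1)[OF coords_omor g] .
  have xP: "?x j \<in> H j" "?x j \<in> carrier G" if "j \<in> I" for j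
    using x osubgroupD(2)[OF sub[OF that]] that by auto
  let ?k = "?x i \<otimes>\<^bsub>G\<^esub> k \<otimes>\<^bsub>G\<^esub> inv\<^bsub>G\<^esub> (?x i)"
  have k': "?k \<in> H i" using osubgroupD(4,5)[OF sub[OF i]] xP(1)[OF i] k by simp
  have kc: "k \<in> carrier G" "?k \<in> carrier G" using osubgroupD(2)[OF sub[OF i]] k k' by auto
  have "?x \<otimes>\<^bsub>?D\<^esub> oinj G I i k = oinj G I i ?k \<otimes>\<^bsub>?D\<^esub> ?x"
    using xP kc i by (auto simp: fun_eq_iff oinj_def m_assoc)
  then have "?\<theta> ?x \<otimes>\<^bsub>G\<^esub> ?\<theta> (oinj G I i k) = ?\<theta> (oinj G I i ?k) \<otimes>\<^bsub>G\<^esub> ?\<theta> ?x"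
    using omorD(2)[OF theta_omor(1)[OF ogroup sub CC]] x oinj_closed[where H = H, OF ogroup sub i] k k' by metis
  then have "g \<otimes>\<^bsub>G\<^esub> k = ?k \<otimes>\<^bsub>G\<^esub> g"
    using theta_coords[OF g] theta_omor(2)[OF ogroup sub CC i] k k' by simp
  then show ?thesis using g kc by (simp add: m_assoc)
qed

text \<open>Conjugation by \<open>g\<close> acts on \<open>H i\<close> like conjugation by an
  element of \<open>H i\<close>, so normality passes up from a summand.\<close>

lemma Zset_summand:
  assumes i: "i \<in> I" and K: "K \<in> Zset Om (osub G (H i))"
  shows "K \<in> Zset Om G"
proof -
  have "onormal Om K (osub G (H i))" "osimple Om (osub G K)" using ZsetD(1,3)[OF K] by auto
  then have Kn: "osubgroup Om K G" "K \<subseteq> H i"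
    "\<And>g n. g \<in> H i \<Longrightarrow> n \<in> K \<Longrightarrow> g \<otimes>\<^bsub>G\<^esub> n \<otimes>\<^bsub>G\<^esub> inv\<^bsub>G\<^esub> g \<in> K"
    by (auto simp: onormal_osub_iff[OF ogroup sub[OF i]])
  have "g \<otimes>\<^bsub>G\<^esub> n \<otimes>\<^bsub>G\<^esub> inv\<^bsub>G\<^esub> g \<in> K" if "g \<in> carrier G" "n \<in> K" for g n
  proof -
    have "coords g i \<in> H i" using omorD(1)[OF proj_omor[OF i] that(1)] by simp
    then show ?thesis using conj_eq_coord_conj[OF i that(1)] Kn(2,3) that(2) by auto
  qed
  then have "onormal Om K G" using Kn(1) by (simp add: onormal_iff[OF ogroup])
  then show ?thesis using \<open>osimple Om (osub G K)\<close> by (simp add: Zset_def)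
qed

text \<open>The coordinate map is onto \<open>H i\<close>, which keeps the image of \<open>K\<close>
  normal there.\<close>

lemma Zset_proj:
  assumes i: "i \<in> I" and K: "K \<in> Zset Om G" and nt: "(\<lambda>y. coords y i) ` K \<noteq> {\<one>\<^bsub>G\<^esub>}"
  shows "(\<lambda>y. coords y i) ` K \<in> Zset Om (osub G (H i))"
    "oiso Om (osub G K) (osub G ((\<lambda>y. coords y i) ` K))"
proof -
  note Hi = osub_ogroup[OF ogroup sub[OF i]]
  have "onormal Om ((\<lambda>y. coords y i) ` K) (osub G (H i))"
    using omor_image_onormal_onto[OF ogroup Hi proj_omor[OF i] proj_onto[OF i] ZsetD(1)[OF K]] .
  from Zset_image[OF ogroup Hi proj_omor[OF i] K this] nt
  show "(\<lambda>y. coords y i) ` K \<in> Zset Om (osub G (H i))"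
    "oiso Om (osub G K) (osub G ((\<lambda>y. coords y i) ` K))" by simp_all
qed

text \<open>The canonical morphism of the smaller family is a restriction of
  \<open>theta Om I H G\<close>, so injectivity is inherited; surjectivity onto \<open>M\<close> is
  exactly the condition \<open>proj\<close> on coordinates.\<close>

lemma theta_bij_sub:
  assumes L: "\<And>i. i \<in> I \<Longrightarrow> osubgroup Om (L i) G" "\<And>i. i \<in> I \<Longrightarrow> L i \<subseteq> H i"
    and M: "osubgroup Om M G" "\<And>i. i \<in> I \<Longrightarrow> L i \<subseteq> M"
    and proj: "\<And>i y. i \<in> I \<Longrightarrow> y \<in> M \<Longrightarrow> coords y i \<in> L i"
  shows "CC (osub G M) I L" "bij_betw (theta Om I L (osub G M)) (carrier (odsub Om I G L)) M"
proof -
  let ?D = "odsub Om I G H" and ?E = "odsub Om I G L"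
  show CL: "CC (osub G M) I L" unfolding CC_def
  proof (intro ballI impI)
    fix i j x y assume ij: "i \<in> I" "j \<in> I" "i \<noteq> j" "x \<in> L i" "y \<in> L j"
    then have "x \<in> H i" "y \<in> H j" using L(2) by blast+
    then show "x \<otimes>\<^bsub>osub G M\<^esub> y = y \<otimes>\<^bsub>osub G M\<^esub> x" using CC ij(1-3) unfolding CC_def by simp
  qed
  have LM: "osubgroup Om (L i) (osub G M)" if "i \<in> I" for i
    using L(1) M that by (simp add: osubgroup_osub_iff[OF ogroup])
  have tL1: "omor Om (odsub Om I (osub G M) L) (osub G M) (theta Om I L (osub G M))"
    by (rule theta_omor(1)[OF osub_ogroup[OF ogroup M(1)] LM CL])
  have tL2: "theta Om I L (osub G M) (oinj (osub G M) I i x) = x" if "i \<in> I" "x \<in> L i" for i x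
    by (rule theta_omor(2)[OF osub_ogroup[OF ogroup M(1)] LM CL that])
  have oi: "oinj (osub G M) I i x = oinj G I i x" for i x unfolding oinj_def osub_simps ..
  have sL: "omor Om ?E G (theta Om I L (osub G M))"
    using omor_from_osub[OF tL1 osubgroupD(2)[OF M(1)]] by simp
  have ED: "carrier ?E \<subseteq> carrier ?D" using L(2) by (auto simp: PiE_iff)
  have tE: "omor Om ?E G (theta Om I H G)"
  proof -
    \<comment> \<open>The direct sum of the \<open>L i\<close> is literally \<open>?D\<close> with a
      smaller carrier, so the large canonical morphism restricts to it.\<close>
    have "osub ?D (carrier ?E) = ?E" by (simp add: osub_def odsum_def omonoid.make_def)
    moreover have "theta Om I H G ` carrier ?E \<subseteq> carrier G"
      using ED omorD(1)[OF theta_omor(1)[OF ogroup sub CC]] by blast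
    ultimately show ?thesis
      using omor_osub[OF theta_omor(1)[OF ogroup sub CC] ED, of "carrier G"] by (simp del: odsum_simps)
  qed
  have eq: "theta Om I L (osub G M) x = theta Om I H G x" if "x \<in> carrier ?E" for x
  proof (rule odsum_omor_eqI[OF ogroup L(1) ogroup sL tE _ that])
    fix i x assume ix: "i \<in> I" "x \<in> L i"
    show "theta Om I L (osub G M) (oinj G I i x) = theta Om I H G (oinj G I i x)"
      using tL2[OF ix, unfolded oi] theta_omor(2)[OF ogroup sub CC ix(1)] L(2)[OF ix(1)] ix(2) by auto
  qed
  show "bij_betw (theta Om I L (osub G M)) (carrier ?E) M"
  proof (rule bij_betw_imageI)
    have "inj_on (theta Om I H G) (carrier ?E)"
      using bij ED inj_on_subset unfolding bij_betw_def by blast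
    then show "inj_on (theta Om I L (osub G M)) (carrier ?E)" by (subst inj_on_cong[OF eq])
    have "y \<in> theta Om I L (osub G M) ` carrier ?E" if y: "y \<in> M" for y
    proof -
      have yc: "y \<in> carrier G" using osubgroupD(2)[OF M(1)] y by blast
      have "coords y \<in> carrier ?D" using omorD(1)[OF coords_omor yc] .
      \<comment> \<open>The preimage of \<open>y\<close> is its coordinate family in the large
        direct sum; \<open>proj\<close> places it in the small one.\<close>
      then have "coords y \<in> carrier ?E" using proj[OF _ y] by (simp add: PiE_iff)
      moreover from this have "theta Om I L (osub G M) (coords y) = y" using eq theta_coords[OF yc] by simp
      ultimately show ?thesis using imageI[of "coords y" "carrier ?E" "theta Om I L (osub G M)"] by simp
    qed
    moreover have "theta Om I L (osub G M) ` carrier ?E \<subseteq> M"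
      using omorD(1)[OF tL1] by (auto simp del: odsum_simps)
    ultimately show "theta Om I L (osub G M) ` carrier ?E = M" by blast
  qed
qed

end

text \<open>The common generalisation of \<^const>\<open>soc\<close> and \<^const>\<open>Gcomp\<close>; \<open>Q\<close> is meant to be
  invariant under isomorphism.\<close>
definition zpart :: "'w set \<Rightarrow> ('w, 'a) omonoid \<Rightarrow> (('w, 'a) omonoid \<Rightarrow> bool) \<Rightarrow> 'a set" where
  "zpart Om G Q = ogen Om G (\<Union>{H \<in> Zset Om G. Q (osub G H)})"

lemma soc_zpart: "soc Om G = zpart Om G (\<lambda>_. True)"
  by (simp add: soc_def zpart_def)

lemma Gcomp_zpart: "Gcomp Om G S = zpart Om G (\<lambda>K. oiso Om K S)"
  by (simp add: Gcomp_eq zpart_def)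

text \<open>Simple normal subgroups of a summand remain so in \<open>G\<close>, which gives one
  inclusion. Conversely a coordinate image of such a subgroup of \<open>G\<close> is trivial or
  isomorphic to it, and this is where the invariance of \<open>Q\<close> enters.\<close>

lemma (in internal_sum) zpart_decomposition:
  assumes Q: "\<forall>K K'. Q K \<longrightarrow> oiso Om K K' \<longrightarrow> Q K'"
  shows "\<And>i. i \<in> I \<Longrightarrow> osubgroup Om (zpart Om (osub G (H i)) Q) (osub G (zpart Om G Q))"
    "CC (osub G (zpart Om G Q)) I (\<lambda>i. zpart Om (osub G (H i)) Q)"
    "bij_betw (theta Om I (\<lambda>i. zpart Om (osub G (H i)) Q) (osub G (zpart Om G Q)))
      (carrier (odsub Om I G (\<lambda>i. zpart Om (osub G (H i)) Q))) (zpart Om G Q)"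
proof -
  define M where "M = zpart Om G Q"
  define L where "L i = zpart Om (osub G (H i)) Q" for i
  have M: "osubgroup Om M G" unfolding M_def zpart_def
    using ZsetD(4) by (intro ogen_osubgroup[OF ogroup]) blast
  have Hi: "ogroup Om (osub G (H i))" if "i \<in> I" for i using osub_ogroup[OF ogroup sub[OF that]] .
  have L: "osubgroup Om (L i) G" "L i \<subseteq> H i" if "i \<in> I" for i
  proof -
    have "osubgroup Om (L i) (osub G (H i))" unfolding L_def zpart_def
      using ZsetD(4) by (intro ogen_osubgroup[OF Hi[OF that]]) blast
    then show "osubgroup Om (L i) G" "L i \<subseteq> H i" by (auto simp: osubgroup_osub_iff[OF ogroup sub[OF that]])
  qed
  have LM: "L i \<subseteq> M" if i: "i \<in> I" for i
  proof -
    let ?A = "\<Union>{K \<in> Zset Om (osub G (H i)). Q (osub (osub G (H i)) K)}"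
    have "?A \<subseteq> H i" using ZsetD(4) by fastforce
    then have "L i = ogen Om G ?A" unfolding L_def zpart_def by (rule ogen_osub[OF ogroup sub[OF i]])
    also have "\<dots> \<subseteq> M" unfolding M_def zpart_def
      using Zset_summand[OF i] by (intro ogen_mono) auto
    finally show ?thesis .
  qed
  have proj: "coords y i \<in> L i" if i: "i \<in> I" and y: "y \<in> M" for i y
  proof -
    have Ls: "osubgroup Om (L i) (osub G (H i))"
      using L[OF i] by (simp add: osubgroup_osub_iff[OF ogroup sub[OF i]])
    have "M \<subseteq> {y \<in> carrier G. coords y i \<in> L i}" unfolding M_def zpart_def
    proof (rule ogen_Union_subset_subgroup[OF ogroup _
          omor_preimage[OF ogroup Hi[OF i] proj_omor[OF i] osubgroupD(1)[OF Ls]]])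
      fix K assume "K \<in> {K \<in> Zset Om G. Q (osub G K)}"
      then have K: "K \<in> Zset Om G" "Q (osub G K)" by auto
      show "osubgroup Om K G" using ZsetD(2)[OF K(1)] .
      have "(\<lambda>y. coords y i) ` K \<subseteq> L i"
      proof (cases "(\<lambda>y. coords y i) ` K = {\<one>\<^bsub>G\<^esub>}")
        case True
        then show ?thesis using osubgroupD(3)[OF L(1)[OF i]] by simp
      next
        case False
        note P = Zset_proj[OF i K(1) False]
        have "Q (osub G ((\<lambda>y. coords y i) ` K))" using Q K(2) P(2) by blast
        then show ?thesis unfolding L_def zpart_def using P(1)
          by (intro order.trans[OF _ ogen_incl] Union_upper) simp
      qed
      then show "K \<subseteq> {y \<in> carrier G. coords y i \<in> L i}" using ZsetD(4)[OF K(1)] by blast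
    qed
    then show ?thesis using y by blast
  qed
  show "osubgroup Om (L i) (osub G M)" if "i \<in> I" for i
    using L(1)[OF that] LM[OF that] by (simp add: osubgroup_osub_iff[OF ogroup M])
  show "CC (osub G M) I L" "bij_betw (theta Om I L (osub G M)) (carrier (odsub Om I G L)) M"
    using theta_bij_sub[OF L M LM proj] by blast+
qed

text \<open>A nontrivial element of \<open>K\<close> has a nontrivial coordinate, and the coordinate
  map then embeds \<open>K\<close> as a member of the \<open>Zset\<close> of that summand.\<close>

lemma (in internal_sum) Supp_decomposition: "Supp Om G = (\<Union>i\<in>I. Supp Om (osub G (H i)))"
proof
  show "(\<Union>i\<in>I. Supp Om (osub G (H i))) \<subseteq> Supp Om G"
  proof (rule UN_least)
    fix i assume i: "i \<in> I"
    show "Supp Om (osub G (H i)) \<subseteq> Supp Om G"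
    proof (rule Supp_subset)
      fix K assume "K \<in> Zset Om (osub G (H i))"
      from Zset_summand[OF i this] have K: "K \<in> Zset Om G" .
      then show "\<exists>K'\<in>Zset Om G. oiso Om (osub G K') (osub (osub G (H i)) K)"
        using oiso_refl[OF ZsetD(6)[OF K]] by auto
    qed
  qed
  show "Supp Om G \<subseteq> (\<Union>i\<in>I. Supp Om (osub G (H i)))"
  proof
    fix C assume "C \<in> Supp Om G"
    then obtain K where K: "K \<in> Zset Om G" "C = isoclass Om (osub G K)" by (auto simp: Supp_def)
    obtain y where y: "y \<in> K" "y \<noteq> \<one>\<^bsub>G\<^esub>" using osubgroup_nontrivial ZsetD(2,5)[OF K(1)] by metis
    then obtain i where i: "i \<in> I" "coords y i \<noteq> \<one>\<^bsub>G\<^esub>"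
      using coords_nontrivial ZsetD(4)[OF K(1)] by blast
    then have "(\<lambda>y. coords y i) ` K \<noteq> {\<one>\<^bsub>G\<^esub>}" using y(1) by blast
    note P = Zset_proj[OF i(1) K(1) this]
    have "C = isoclass Om (osub (osub G (H i)) ((\<lambda>y. coords y i) ` K))"
      using K(2) isoclass_eq[OF P(2)] by simp
    then have "C \<in> Supp Om (osub G (H i))" using P(1) unfolding Supp_def by blast
    then show "C \<in> (\<Union>i\<in>I. Supp Om (osub G (H i)))" using i(1) by blast
  qed
qed

theorem mainTheorem2:
  fixes Om :: "'w set"
  shows
  \<comment> \<open>(1)\<close>
  "(\<forall>(G :: ('w, 'a) omonoid) (I :: 'i set) H (S :: ('w, 's) omonoid).
      ogroup Om G \<and> (\<forall>i\<in>I. osubgroup Om (H i) G) \<and> CC G I H \<and>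
      bij_betw (theta Om I H G) (carrier (odsum Om I (\<lambda>i. osub G (H i)))) (carrier G) \<and>
      osimple Om S \<longrightarrow>
        (\<forall>i\<in>I. osubgroup Om (soc Om (osub G (H i))) (osub G (soc Om G)) \<and>
                osubgroup Om (Gcomp Om (osub G (H i)) S) (osub G (Gcomp Om G S))) \<and>
        CC (osub G (soc Om G)) I (\<lambda>i. soc Om (osub G (H i))) \<and>
        CC (osub G (Gcomp Om G S)) I (\<lambda>i. Gcomp Om (osub G (H i)) S) \<and>
        bij_betw (theta Om I (\<lambda>i. soc Om (osub G (H i))) (osub G (soc Om G)))
          (carrier (odsum Om I (\<lambda>i. osub G (soc Om (osub G (H i))))))
          (soc Om G) \<and>
        bij_betw (theta Om I (\<lambda>i. Gcomp Om (osub G (H i)) S) (osub G (Gcomp Om G S)))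
          (carrier (odsum Om I (\<lambda>i. osub G (Gcomp Om (osub G (H i)) S))))
          (Gcomp Om G S) \<and>
        Supp Om G = (\<Union>i\<in>I. Supp Om (osub G (H i))))
   \<and>
  \<comment> \<open>(2)\<close>
   (\<forall>(G :: ('w, 'a) omonoid) (S :: ('w, 's) omonoid).
      ogroup Om G \<and> osimple Om S \<longrightarrow>
        Gcomp Om G S = Gcomp Om (osub G (soc Om G)) S \<and>
        Supp Om G = Supp Om (osub G (soc Om G)))
   \<and>
  \<comment> \<open>(3)\<close>
   (\<forall>(G :: ('w, 'a) omonoid) (G' :: ('w, 'b) omonoid).
      semisimple Om G \<and> semisimple Om G' \<longrightarrow>
        (\<forall>f\<in>Hom_n Om G G'. \<forall>S :: ('w, 's) omonoid. osimple Om S \<longrightarrow>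
            restrict f (Gcomp Om G S) \<in> Hom_n Om (osub G (Gcomp Om G S)) (osub G' (Gcomp Om G' S))) \<and>
        bij_betw (\<lambda>f. \<lambda>C\<in>Supp_meet Om G G'. restrict f (compC Om G C))
          (Hom_n Om G G')
          (\<Pi>\<^sub>E C\<in>Supp_meet Om G G'. Hom_n Om (osub G (compC Om G C)) (osub G' (compC Om G' C))))"
proof (intro conjI allI impI ballI)
  fix G :: "('w, 'a) omonoid" and I :: "'i set" and H and S :: "('w, 's) omonoid"
  assume a: "ogroup Om G \<and> (\<forall>i\<in>I. osubgroup Om (H i) G) \<and> CC G I H \<and>
      bij_betw (theta Om I H G) (carrier (odsum Om I (\<lambda>i. osub G (H i)))) (carrier G) \<and> osimple Om S"
  then interpret internal_sum Om G I H by unfold_locales blast+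
  \<comment> \<open>The constantly true predicate is trivially invariant, so socle and component are
    two instances of one decomposition.\<close>
  note soc = zpart_decomposition[of "\<lambda>_. True", folded soc_zpart]
  have iso: "\<forall>(K :: ('w, 'a) omonoid) (K' :: ('w, 'a) omonoid). oiso Om K S \<longrightarrow> oiso Om K K' \<longrightarrow> oiso Om K' S"
    using oiso_trans oiso_sym by blast
  note comp = zpart_decomposition[where Q = "\<lambda>K. oiso Om K S", folded Gcomp_zpart, OF iso]
  show "osubgroup Om (soc Om (osub G (H i))) (osub G (soc Om G))" if "i \<in> I" for i
    using soc(1) that by simp
  show "osubgroup Om (Gcomp Om (osub G (H i)) S) (osub G (Gcomp Om G S))" if "i \<in> I" for i
    using comp(1) that by blast
  show "CC (osub G (soc Om G)) I (\<lambda>i. soc Om (osub G (H i)))"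
    "bij_betw (theta Om I (\<lambda>i. soc Om (osub G (H i))) (osub G (soc Om G)))
      (carrier (odsum Om I (\<lambda>i. osub G (soc Om (osub G (H i)))))) (soc Om G)"
    using soc(2,3) by simp_all
  show "CC (osub G (Gcomp Om G S)) I (\<lambda>i. Gcomp Om (osub G (H i)) S)"
    "bij_betw (theta Om I (\<lambda>i. Gcomp Om (osub G (H i)) S) (osub G (Gcomp Om G S)))
      (carrier (odsum Om I (\<lambda>i. osub G (Gcomp Om (osub G (H i)) S)))) (Gcomp Om G S)"
    using comp(2,3) by blast+
  show "Supp Om G = (\<Union>i\<in>I. Supp Om (osub G (H i)))" by (rule Supp_decomposition)
next
  fix G :: "('w, 'a) omonoid" and S :: "('w, 's) omonoid"
  assume "ogroup Om G \<and> osimple Om S"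
  then show "Gcomp Om G S = Gcomp Om (osub G (soc Om G)) S" "Supp Om G = Supp Om (osub G (soc Om G))"
    using Gcomp_soc Supp_soc by metis+
next
  fix G :: "('w, 'a) omonoid" and G' :: "('w, 'b) omonoid"
  assume ss: "semisimple Om G \<and> semisimple Om G'"
  show "restrict f (Gcomp Om G S) \<in> Hom_n Om (osub G (Gcomp Om G S)) (osub G' (Gcomp Om G' S))"
    if "f \<in> Hom_n Om G G'" for f and S :: "('w, 's) omonoid"
    using Hom_n_restrict_Gcomp ss that by blast
  show "bij_betw (\<lambda>f. \<lambda>C\<in>Supp_meet Om G G'. restrict f (compC Om G C)) (Hom_n Om G G')
    (\<Pi>\<^sub>E C\<in>Supp_meet Om G G'. Hom_n Om (osub G (compC Om G C)) (osub G' (compC Om G' C)))"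
    using Hom_n_components_bij ss by blast
qed

end
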